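(* Let $p<q$, $q>0$. For every $t>1$ and $z\in(-1,1)$: $\frac{\partial\tilde J}{\partial t}(p,q,t,z)<0$ if $0\le -p<q\le 2$, and $\frac{\partial\tilde J}{\partial t}(p,q,t,z)>0$ if $-p>q\ge 2$. Moreover, for every $r>1$: $\frac{\partial\Theta}{\partial r}(p,q,r)<0$ if $0\le -p<q\le 2$, and $\frac{\partial\Theta}{\partial r}(p,q,r)>0$ if $-p>q\ge 2$.
   Context: Let $q>0$, $p<q$, $t>1$, $z\in(-1,1)$. If $p\ne0$, set $\rho=p/q$, $A=\big(\frac{t+1}{t+z}\big)^{\frac{3}{2-\rho}}$, $B=\big(\frac{t-1}{t+z}\big)^{\frac{3}{2-\rho}}$, $K_\rho(t,z)=\frac{A^{1-\rho}-B^{1-\rho}}{A^{-\rho}-B^{-\rho}}+\frac{A-B}{A^{\rho}-B^{\rho}}$, and $\tilde J(p,q,t,z)=(z+t)^2\big[K_\rho(t,z)^{2/q}-1\big]$. If $p=0$, set $A=\big(\frac{t+1}{t+z}\big)^{3/2}$, $B=\big(\frac{t-1}{t+z}\big)^{3/2}$, $L(t,z)=\frac{B\log A-A\log B}{\log A-\log B}$, and $\tilde J(0,q,t,z)=(z+t)^2\big[L(t,z)^{2/q}-1\big]$. The period function is $\Theta(p,q,r)=\int_1^r\Big(\big(\frac{r^p-r^q}{r^p-1}+\frac{r^q-1}{r^p-1}x^p\big)^{2/q}-x^2\Big)^{-1/2}dx$ for $p\ne0$ and $\Theta(0,q,r)=\int_1^r\Big(\big(1+\frac{r^q-1}{\log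 r}\log x\big)^{2/q}-x^2\Big)^{-1/2}dx$; with $\beta_0=\frac{2q-p}{3}$ and $t=\frac{r^{\beta_0}+1}{r^{\beta_0}-1}$ one has $\Theta(p,q,r)=\int_{-1}^1\frac{dz}{\beta_0\sqrt{\tilde J(p,q,t,z)}}$. *)

theory Defs
  imports "HOL-Analysis.Analysis"
begin

definition Krho :: "real \<Rightarrow> real \<Rightarrow> real \<Rightarrow> real" where
  "Krho \<rho> t z =
     (let A = ((t + 1) / (t + z)) powr (3 / (2 - \<rho>));
          B = ((t - 1) / (t + z)) powr (3 / (2 - \<rho>))
      in (A powr (1 - \<rho>) - B powr (1 - \<rho>)) / (A powr (- \<rho>) - B powr (- \<rho>))
         + (A - B) / (A powr \<rho> - B powr \<rho>))"

definition Lfun :: "real \<Rightarrow> real \<Rightarrow> real" where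
  "Lfun t z =
     (let A = ((t + 1) / (t + z)) powr (3 / 2);
          B = ((t - 1) / (t + z)) powr (3 / 2)
      in (B * ln A - A * ln B) / (ln A - ln B))"

definition Jt :: "real \<Rightarrow> real \<Rightarrow> real \<Rightarrow> real \<Rightarrow> real" where
  "Jt p q t z =
     (if p \<noteq> 0 then (z + t)^2 * ((Krho (p / q) t z) powr (2 / q) - 1)
      else (z + t)^2 * ((Lfun t z) powr (2 / q) - 1))"

text \<open>The period function Theta (p, q, r), an (improper) integral over [1, r].\<close>
definition Theta :: "real \<Rightarrow> real \<Rightarrow> real \<Rightarrow> real" where
  "Theta p q r =
     (if p \<noteq> 0 then
        integral {1..r} (\<lambda>x. 1 / sqrt
          ((((r powr p - r powr q) / (r powr p - 1) + (r powr q - 1) / (r powr p - 1) * x powr p)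
             powr (2 / q)) - x^2))
      else
        integral {1..r} (\<lambda>x. 1 / sqrt
          (((1 + (r powr q - 1) / ln r * ln x) powr (2 / q)) - x^2)))"

end

theory Submission
  imports Defs
begin

text \<open>
  Put \<open>\<alpha> = 3 / (2 - p/q)\<close> and \<open>\<gamma> = 3 - 2\<alpha>\<close> (written \<open>al\<close>, \<open>g\<close>), \<open>w = t + z\<close>, and let \<open>\<omega>\<close> be the
  primitive of \<open>w powr (-\<gamma> - 1)\<close> with \<open>\<omega> 1 = 0\<close>; it is logarithmic exactly when \<open>p = 0\<close>, so both cases of the
  definitions become \<open>K = w powr (-\<alpha>) * (P t + Q t * \<omega> w)\<close>, with \<open>K = 1\<close> at \<open>z = 1\<close> and \<open>z = -1\<close>.
  A tangent inequality for \<open>K powr (2/q)\<close> reduces the sign of the derivative of \<open>J\<close> to the case \<open>q = 2\<close>.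
  There the derivative, as a function of \<open>w\<close>, vanishes at both ends of \<open>[t - 1, t + 1]\<close> and lies in a
  five-dimensional Chebyshev space; a Rolle argument shows that it keeps its sign as soon as its slopes at
  the two ends have the right sign. These slopes are derivatives of one explicit function of the ratio
  \<open>(t + 1) / (t - 1)\<close> or its inverse, and their sign comes from an exponential sum whose number of sign changes
  equals the order of its zero at the origin.
  For \<open>Theta\<close>, the substitution of the paper gives a multiple of the integral of \<open>J powr (-1/2)\<close>. Comparison
  of \<open>J\<close> and its derivative with \<open>1 - z\<^sup>2\<close>, locally uniformly in \<open>t\<close>, permits differentiation under the
  integral sign.
\<close>

section \<open>Exponential sums and the slope function\<close>

definition expsum :: "(real \<times> real) list \<Rightarrow> real \<Rightarrow> real" where
  "expsum cs v = (\<Sum>(c, k)\<leftarrow>cs. c * exp (k * v))"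

text \<open>The operator \<open>d/dv - m\<close>, acting termwise: a term with exponent
  \<open>m\<close> gets coefficient 0, which is how exponents are eliminated one after
  another.\<close>

definition expsum_op :: "real \<Rightarrow> (real \<times> real) list \<Rightarrow> (real \<times> real) list" where
  "expsum_op m cs = map (\<lambda>(c, k). (c * (k - m), k)) cs"

lemma expsum_op_simps [simp]:
  "expsum_op m [] = []"
  "expsum_op m ((c, k) # cs) = (c * (k - m), k) # expsum_op m cs"
  by (simp_all add: expsum_op_def)

lemma expsum_simps [simp]:
  "expsum [] v = 0"
  "expsum ((c, k) # cs) v = c * exp (k * v) + expsum cs v"
  by (simp_all add: expsum_def)

text \<open>The integrating factor \<open>exp (- m * v)\<close> turns \<open>d/dv - m\<close> into a
  plain derivative, so that the mean value theorem can carry signs back through the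
  operator.\<close>

lemma expsum_deriv:
  "((\<lambda>v. exp (- m * v) * expsum cs v) has_real_derivative
      exp (- m * v) * expsum (expsum_op m cs) v) (at v)"
proof (induction cs)
  case Nil
  then show ?case by simp
next
  case (Cons ck cs)
  obtain c k where ck: "ck = (c, k)" by fastforce
  have 1: "((\<lambda>v. exp (- m * v) * (c * exp (k * v))) has_real_derivative
      exp (- m * v) * (c * (k - m) * exp (k * v))) (at v)"
    by (auto intro!: derivative_eq_intros simp: algebra_simps)
  from DERIV_add[OF 1 Cons.IH] show ?case
    by (simp add: ck algebra_simps)
qed

text \<open>The \<open>j\<close>-th derivative of \<open>expsum cs\<close> at 0. Vanishing at the
  origin thus becomes a polynomial identity in coefficients and exponents.\<close>

definition moment :: "(real \<times> real) list \<Rightarrow> nat \<Rightarrow> real" where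
  "moment cs j = (\<Sum>(c, k)\<leftarrow>cs. c * k ^ j)"

lemma moment_simps [simp]:
  "moment [] j = 0"
  "moment ((c, k) # cs) j = c * k ^ j + moment cs j"
  by (simp_all add: moment_def)

lemma moment_expsum_op: "moment (expsum_op m cs) j = moment cs (Suc j) - m * moment cs j"
  by (induction cs) (auto simp: algebra_simps)

lemma expsum_zero: "expsum cs 0 = moment cs 0"
  by (induction cs) auto

text \<open>Descartes' rule of signs in the case where all zeros sit at the origin: each operator
  \<open>d/dv - m\<close> removes one sign change and one order of vanishing.\<close>
lemma expsum_sign:
  assumes "\<And>j. j < length ms \<Longrightarrow> moment cs j = 0"
    and "\<And>v. expsum (fold expsum_op ms cs) v > 0"
  shows "v > 0 \<Longrightarrow> expsum cs v > 0"
    and "v < 0 \<Longrightarrow> (- 1) ^ length ms * expsum cs v > 0"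
proof -
  have "(v > 0 \<longrightarrow> expsum cs v > 0) \<and> (v < 0 \<longrightarrow> (- 1) ^ length ms * expsum cs v > 0)" for v
    using assms
  proof (induction ms arbitrary: cs v)
    case Nil
    then show ?case by simp
  next
    case (Cons m ms)
    define g where "g = expsum (expsum_op m cs)"
    define F where "F = (\<lambda>v. exp (- m * v) * expsum cs v)"
    have F: "(F has_real_derivative exp (- m * x) * g x) (at x)" for x
      unfolding F_def g_def by (rule expsum_deriv)
    have IH: "(x > 0 \<longrightarrow> g x > 0) \<and> (x < 0 \<longrightarrow> (- 1) ^ length ms * g x > 0)" for x
      unfolding g_def
    proof (rule Cons.IH)
      show "moment (expsum_op m cs) j = 0" if "j < length ms" for j
        using that Cons.prems(1)[of j] Cons.prems(1)[of "Suc j"] by (simp add: moment_expsum_op)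
      show "0 < expsum (fold expsum_op ms (expsum_op m cs)) w" for w
        using Cons.prems(2)[of w] by simp
    qed
    have F0: "F 0 = 0"
      using Cons.prems(1)[of 0] by (simp add: F_def expsum_zero)
    have "expsum cs v > 0" if v: "v > 0"
    proof -
      obtain x where "0 < x" "x < v" "F v - F 0 = (v - 0) * (exp (- m * x) * g x)"
        using MVT2[OF v F] by blast
      then have "F v > 0" using F0 IH[of x] v by simp
      then show ?thesis by (simp add: F_def zero_less_mult_iff)
    qed
    moreover have "(- 1) ^ length (m # ms) * expsum cs v > 0" if v: "v < 0"
    proof -
      obtain x where x: "v < x" "x < 0" "F 0 - F v = (0 - v) * (exp (- m * x) * g x)"
        using MVT2[OF v F] by blast
      then have "(- 1) ^ length (m # ms) * F v = - v * (exp (- m * x) * ((- 1) ^ length ms * g x))"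
        using F0 by (simp add: algebra_simps)
      also have "\<dots> > 0"
        using IH[of x] x v by (metis exp_gt_zero mult_pos_pos neg_0_less_iff_less)
      finally have "0 < exp (- m * v) * ((- 1) ^ length (m # ms) * expsum cs v)"
        by (simp add: F_def algebra_simps)
      then show ?thesis by (simp only: zero_less_mult_iff exp_gt_zero) simp
    qed
    ultimately show ?case by blast
  qed
  then show "v > 0 \<Longrightarrow> expsum cs v > 0" "v < 0 \<Longrightarrow> (- 1) ^ length ms * expsum cs v > 0"
    by blast+
qed

text \<open>Coefficients and exponents obtained by expanding the numerator \<open>slope_num\<close> below at \<open>y = exp (2u)\<close>,
  scaled by \<open>2 g\<^sup>2 exp (2gu)\<close>. The exponent \<open>al = (3 - g) / 2\<close> is what makes the zero at 0 five-fold.\<close>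
definition slope_terms :: "real \<Rightarrow> (real \<times> real) list" where
  "slope_terms g = [(g * (1 - g), 3 + g), (- g * (1 + g), 3 - g), (- g * (3 - g), 1 + g),
     (g * (3 + g), 1 - g), (3 + g, 2 * g), (3 - g, - 2 * g), (- 2 * g\<^sup>2, - 2), (2 * g\<^sup>2 - 6, 0)]"

lemma moment_slope_terms: "j < 5 \<Longrightarrow> moment (slope_terms g) j = 0"
proof -
  assume "j < 5"
  then consider "j = 0" | "j = 1" | "j = 2" | "j = 3" | "j = 4" by linarith
  then show ?thesis
    by cases (simp_all add: slope_terms_def algebra_simps eval_nat_numeral)
qed

section \<open>Sign of the exponential sum and of \<open>slope_num\<close>\<close>

lemma slope_terms_pos_lt1:
  assumes "0 < g" "g < 1"
  shows "u > 0 \<Longrightarrow> expsum (slope_terms g) u > 0" "u < 0 \<Longrightarrow> expsum (slope_terms g) u < 0"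
proof -
  \<comment> \<open>These roots annihilate five of the eight terms. The survivors, with exponents
    \<open>3 + g\<close>, \<open>2 * g\<close> and \<open>1 - g\<close>, all receive positive
    coefficients for \<open>0 < g < 1\<close>. The odd length gives the opposite sign for negative
    \<open>u\<close>.\<close>
  let ?ms = "[3 - g, 1 + g, 0, - 2 * g, - 2]"
  have m: "moment (slope_terms g) j = 0" if "j < length ?ms" for j
    using that by (intro moment_slope_terms) simp
  have p: "expsum (fold expsum_op ?ms (slope_terms g)) v > 0" for v
  proof -
    have "expsum (fold expsum_op ?ms (slope_terms g)) v =
       g * (1 - g) * (2 * g) * 2 * (3 + g) * (3 + 3 * g) * (5 + g) * exp ((3 + g) * v)
       + (3 + g) * (3 * (1 - g)) * (1 - g) * (2 * g) * (4 * g) * (2 * g + 2) * exp (2 * g * v)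
       + g * (3 + g) * 2 * (2 * g) * (1 - g) * (1 + g) * (3 - g) * exp ((1 - g) * v)"
      by (simp add: slope_terms_def algebra_simps)
    also have "\<dots> > 0"
      using assms by (intro add_pos_pos mult_pos_pos) auto
    finally show ?thesis .
  qed
  show "u > 0 \<Longrightarrow> expsum (slope_terms g) u > 0" "u < 0 \<Longrightarrow> expsum (slope_terms g) u < 0"
    using expsum_sign[OF m p, of u] by (simp_all del: fold_simps)
qed


lemma slope_terms_neg_gt1:
  assumes "1 < g" "g < 3"
  shows "u > 0 \<Longrightarrow> expsum (slope_terms g) u < 0" "u < 0 \<Longrightarrow> expsum (slope_terms g) u > 0"
proof -
  \<comment> \<open>After the change of sign the survivors are \<open>3 + g\<close>,
    \<open>3 - g\<close> and \<open>1 - g\<close>. The root 0 removes the constant term, whose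
    coefficient has no fixed sign on \<open>1 < g < 3\<close>.\<close>
  let ?ms = "[2 * g, 1 + g, 0, - 2, - 2 * g]"
  let ?cs = "map (\<lambda>(c, k). (- c, k)) (slope_terms g)"
  have m: "moment ?cs j = 0" if "j < length ?ms" for j
  proof -
    have "moment ?cs j = - moment (slope_terms g) j"
      by (simp add: slope_terms_def algebra_simps)
    then show ?thesis
      using that moment_slope_terms[of j g] by simp
  qed
  have p: "expsum (fold expsum_op ?ms ?cs) v > 0" for v
  proof -
    have "expsum (fold expsum_op ?ms ?cs) v =
       g * (g - 1) * (3 - g) * 2 * (3 + g) * (5 + g) * (3 + 3 * g) * exp ((3 + g) * v)
       + g * (1 + g) * (3 * (g - 1)) * (2 * (g - 1)) * (3 - g) * (5 - g) * (3 + g) * exp ((3 - g) * v)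
       + g * (3 + g) * (3 * g - 1) * (2 * g) * (g - 1) * (3 - g) * (1 + g) * exp ((1 - g) * v)"
      by (simp add: slope_terms_def algebra_simps)
    also have "\<dots> > 0"
      using assms by (intro add_pos_pos mult_pos_pos) auto
    finally show ?thesis .
  qed
  have e: "expsum ?cs u = - expsum (slope_terms g) u"
    by (simp add: slope_terms_def algebra_simps)
  show "u > 0 \<Longrightarrow> expsum (slope_terms g) u < 0" "u < 0 \<Longrightarrow> expsum (slope_terms g) u > 0"
    using expsum_sign[OF m p, of u] unfolding e by (simp_all del: fold_simps)
qed

text \<open>The normalisation at 1 makes the family continuous in \<open>g\<close> through the logarithmic case.\<close>
definition pow_prim :: "real \<Rightarrow> real \<Rightarrow> real" where
  "pow_prim g w = (if g = 0 then ln w else (1 - w powr (- g)) / g)"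

lemma pow_prim_deriv:
  assumes "w > 0"
  shows "(pow_prim g has_real_derivative w powr (- g - 1)) (at w)"
proof (cases "g = 0")
  case True
  have "(ln has_real_derivative 1 / w) (at w)"
    using assms by (auto intro!: derivative_eq_intros)
  moreover have "pow_prim g = ln" "w powr (- g - 1) = 1 / w"
    using assms True by (auto simp: pow_prim_def powr_minus field_simps)
  ultimately show ?thesis by simp
next
  case False
  have "((\<lambda>w. (1 - w powr (- g)) / g) has_real_derivative w powr (- g - 1)) (at w)"
    using assms False by (auto intro!: derivative_eq_intros)
  moreover have "pow_prim g = (\<lambda>w. (1 - w powr (- g)) / g)"
    using False by (auto simp: pow_prim_def)
  ultimately show ?thesis by simp
qed

lemma pow_prim_one [simp]: "pow_prim g 1 = 0"
  by (simp add: pow_prim_def)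

lemma pow_prim_less:
  assumes "0 < x" "x < y"
  shows "pow_prim g x < pow_prim g y"
  by (rule DERIV_pos_imp_increasing[OF \<open>x < y\<close>])
     (use assms in \<open>force intro!: pow_prim_deriv exI\<close>)

text \<open>The derivative is homogeneous of degree \<open>- g - 1\<close>, so a dilation changes
  increments only by a factor. This later reduces the two ends \<open>t - 1\<close> and
  \<open>t + 1\<close> to their ratio.\<close>

lemma pow_prim_scale:
  assumes "0 < b" "0 < y"
  shows "pow_prim g (b * y) - pow_prim g b = b powr (- g) * pow_prim g y"
proof (cases "g = 0")
  case True
  then show ?thesis using assms by (simp add: pow_prim_def ln_mult)
next
  case False
  then show ?thesis using assms by (simp add: pow_prim_def powr_mult field_simps)
qed

text \<open>The numerator of the derivative of \<open>((y powr al - 1) / pow_prim g y - al) / (y - 1)\<close>.\<close>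
definition slope_num :: "real \<Rightarrow> real \<Rightarrow> real \<Rightarrow> real" where
  "slope_num g al y = al * (pow_prim g y)\<^sup>2 + pow_prim g y * ((al - 1) * y powr al - al * y powr (al - 1) + 1)
     - (y powr al - 1) * (y powr (- g) - y powr (- g - 1))"

lemma slope_num_expsum:
  assumes "g \<noteq> 0" "al = (3 - g) / 2"
  shows "slope_num g al (exp (2 * u)) = exp (- 2 * g * u) / (2 * g\<^sup>2) * expsum (slope_terms g) u"
proof -
  \<comment> \<open>Since \<open>al = (3 - g) / 2\<close>, the power \<open>y powr al\<close> is
    \<open>X ^ 3 / Y\<close>. All powers that occur are Laurent monomials in \<open>X\<close> and
    \<open>Y\<close>, and the claim becomes a rational identity.\<close>
  define X Y where "X = exp u" and "Y = exp (g * u)"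
  have XY: "X > 0" "Y > 0" by (auto simp: X_def Y_def)
  have X3: "exp (3 * u) = exp u ^ 3"
    by (simp add: power3_eq_cube flip: exp_add)
  have pow_prim: "pow_prim g (exp (2 * u)) = (1 - 1 / Y\<^sup>2) / g"
    using assms by (simp add: pow_prim_def powr_def Y_def exp_minus field_simps flip: exp_double)
  have p1: "exp (2 * u) powr al = X ^ 3 / Y"
  proof -
    have "exp (2 * u) powr al = exp (3 * u - g * u)"
      by (simp add: powr_def assms(2) field_simps)
    then show ?thesis by (simp add: X_def Y_def exp_diff X3)
  qed
  have p2: "exp (2 * u) powr (al - 1) = X / Y"
  proof -
    have "exp (2 * u) powr (al - 1) = exp (u - g * u)"
      by (simp add: powr_def assms(2) field_simps)
    then show ?thesis by (simp add: X_def Y_def exp_diff)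
  qed
  have p3: "exp (2 * u) powr (- g) = 1 / Y\<^sup>2"
    by (simp add: powr_def Y_def exp_minus field_simps flip: exp_double)
  have p4: "exp (2 * u) powr (- g - 1) = 1 / (Y\<^sup>2 * X\<^sup>2)"
  proof -
    have "exp (2 * u) powr (- g - 1) = exp (- (2 * (g * u)) - 2 * u)"
      by (simp add: powr_def algebra_simps)
    then show ?thesis by (simp add: X_def Y_def exp_diff exp_minus field_simps flip: exp_double)
  qed
  have q: "exp (- 2 * g * u) = 1 / Y\<^sup>2"
    by (simp add: Y_def exp_minus field_simps flip: exp_double)
  have e: "exp ((3 + g) * u) = X ^ 3 * Y" "exp ((3 - g) * u) = X ^ 3 / Y" "exp ((1 + g) * u) = X * Y"
     "exp ((1 - g) * u) = X / Y" "exp (2 * g * u) = Y\<^sup>2" "exp (- 2 * u) = 1 / X\<^sup>2"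
    by (simp_all add: X_def Y_def exp_diff exp_minus distrib_right left_diff_distrib exp_add
         X3 inverse_eq_divide mult.assoc flip: exp_double)
  have e2: "exp (- (2 * g * u)) = 1 / Y\<^sup>2" "exp (- (2 * u)) = 1 / X\<^sup>2"
    using q e by simp_all
  have s: "expsum (slope_terms g) u = g * (1 - g) * (X ^ 3 * Y) - g * (1 + g) * (X ^ 3 / Y)
     - g * (3 - g) * (X * Y) + g * (3 + g) * (X / Y) + (3 + g) * Y\<^sup>2 + (3 - g) / Y\<^sup>2
     - 2 * g\<^sup>2 / X\<^sup>2 + 2 * g\<^sup>2 - 6"
    by (simp add: slope_terms_def e e2)
  show ?thesis
    unfolding slope_num_def pow_prim p1 p2 p3 p4 q s
    unfolding assms(2)
    using XY assms(1) by (simp add: divide_simps) algebra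
qed

text \<open>For \<open>g = 0\<close> the exponents in \<open>slope_terms\<close> merge and
  polynomial coefficients appear. The sign is obtained instead by repeated differentiation of
  \<open>D u\<close>, the value at \<open>y = exp (2 * u)\<close>; the functions in the chain all
  vanish at 0.\<close>

lemma slope_num_zero_sign:
  assumes "y > 0" "y \<noteq> 1"
  shows "(y - 1) * slope_num 0 (3/2) y > 0"
proof -
  define D where "D = (\<lambda>u::real. (u - 1) * exp (3 * u) + (1 - 3 * u) * exp u + 1 + 2 * u + 6 * u\<^sup>2 - exp (- 2 * u))"
  define D1 where "D1 = (\<lambda>u::real. (3 * u - 2) * exp (3 * u) + (- 2 - 3 * u) * exp u + 2 + 12 * u + 2 * exp (- 2 * u))"
  define D2 where "D2 = (\<lambda>u::real. (9 * u - 3) * exp (3 * u) + (- 5 - 3 * u) * exp u + 12 - 4 * exp (- 2 * u))"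
  \<comment> \<open>Positive exponential factors are split off before differentiating again:
    \<open>H\<close> is \<open>exp (2 * u)\<close> times the derivative of \<open>D2\<close>, and
    \<open>E\<close> is the derivative of \<open>H\<close> divided by
    \<open>9 * exp (3 * u)\<close>.\<close>
  define H where "H = (\<lambda>u::real. 27 * u * exp (5 * u) - (8 + 3 * u) * exp (3 * u) + 8)"
  define E where "E = (\<lambda>u::real. (15 * u + 3) * exp (2 * u) - (u + 3))"
  have dD: "(D has_real_derivative D1 u) (at u)" for u
    unfolding D_def D1_def by (auto intro!: derivative_eq_intros simp: algebra_simps)
  have dD1: "(D1 has_real_derivative D2 u) (at u)" for u
    unfolding D1_def D2_def by (auto intro!: derivative_eq_intros simp: algebra_simps)
  have dD2: "(D2 has_real_derivative exp (- 2 * u) * H u) (at u)" for u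
  proof -
    have "(D2 has_real_derivative 27 * u * exp (3 * u) - (8 + 3 * u) * exp u + 8 * exp (- 2 * u)) (at u)"
      unfolding D2_def by (auto intro!: derivative_eq_intros simp: algebra_simps)
    moreover have "exp (- 2 * u) * H u = 27 * u * exp (3 * u) - (8 + 3 * u) * exp u + 8 * exp (- 2 * u)"
      by (simp add: H_def algebra_simps flip: exp_add)
    ultimately show ?thesis by simp
  qed
  have dH: "(H has_real_derivative 9 * exp (3 * u) * E u) (at u)" for u
  proof -
    have "(H has_real_derivative (135 * u + 27) * exp (5 * u) - (9 * u + 27) * exp (3 * u)) (at u)"
      unfolding H_def by (auto intro!: derivative_eq_intros simp: algebra_simps)
    moreover have "9 * exp (3 * u) * E u = (135 * u + 27) * exp (5 * u) - (9 * u + 27) * exp (3 * u)"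
      by (simp add: E_def algebra_simps flip: exp_add)
    ultimately show ?thesis by simp
  qed
  have z: "D 0 = 0" "D1 0 = 0" "D2 0 = 0" "H 0 = 0" "E 0 = 0"
    by (simp_all add: D_def D1_def D2_def H_def E_def)
  have pos: "f u > 0" if "f 0 = 0" "\<And>u. (f has_real_derivative f' u) (at u)" "\<And>u. u > 0 \<Longrightarrow> f' u > 0" "u > 0"
    for f f' :: "real \<Rightarrow> real" and u
    using MVT2[of 0 u f f'] that by (auto simp: zero_less_mult_iff)
  have neg: "f u < 0" if "f 0 = 0" "\<And>u. (f has_real_derivative f' u) (at u)" "\<And>u. u < 0 \<Longrightarrow> f' u > 0" "u < 0"
    for f f' :: "real \<Rightarrow> real" and u
    using MVT2[of u 0 f f'] that by (metis add.inverse_neutral diff_0 diff_0_right mult_pos_pos neg_0_less_iff_less)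
  have neg': "f u > 0" if "f 0 = 0" "\<And>u. (f has_real_derivative f' u) (at u)" "\<And>u. u < 0 \<Longrightarrow> f' u < 0" "u < 0"
    for f f' :: "real \<Rightarrow> real" and u
    using neg[of "\<lambda>u. - f u" "\<lambda>u. - f' u" u] that by (auto intro!: derivative_intros)
  \<comment> \<open>\<open>E\<close> changes sign on the negative axis, so \<open>H\<close> is
    treated directly there. With \<open>v = - u\<close> it is a positive multiple of
    \<open>M v\<close>, and \<open>M\<close>, \<open>M1\<close> vanish at 0 and have positive
    derivatives for \<open>v > 0\<close>.\<close>
  have Hpos: "H u > 0" if u: "u < 0" for u
  proof -
    define M where "M = (\<lambda>v::real. 8 * exp (5 * v) - (8 - 3 * v) * exp (2 * v) - 27 * v)"
    define M1 where "M1 = (\<lambda>v::real. 40 * exp (5 * v) - (13 - 6 * v) * exp (2 * v) - 27)"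
    have M1: "M1 v > 0" if "v > 0" for v
    proof (rule pos[of M1 "\<lambda>v. 200 * exp (5 * v) - (20 - 12 * v) * exp (2 * v)", OF _ _ _ that])
      show "M1 0 = 0" by (simp add: M1_def)
      show "(M1 has_real_derivative 200 * exp (5 * v) - (20 - 12 * v) * exp (2 * v)) (at v)" for v
        unfolding M1_def by (auto intro!: derivative_eq_intros simp: algebra_simps)
      show "0 < 200 * exp (5 * v) - (20 - 12 * v) * exp (2 * v)" if "v > 0" for v :: real
      proof -
        have "(20 - 12 * v) * exp (2 * v) \<le> 20 * exp (2 * v)"
          using that by (intro mult_right_mono) auto
        also have "\<dots> < 200 * exp (5 * v)"
        proof -
          have "exp (2 * v) < exp (5 * v)" using that by simp
          then show ?thesis using exp_gt_zero[of "5 * v"] by linarith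
        qed
        finally show ?thesis by simp
      qed
    qed
    have "M (- u) > 0"
    proof (rule pos[of M M1, OF _ _ M1])
      show "(M has_real_derivative M1 v) (at v)" for v
        unfolding M_def M1_def by (auto intro!: derivative_eq_intros simp: algebra_simps)
    qed (use u in \<open>auto simp: M_def\<close>)
    moreover have "H u = exp (5 * u) * M (- u)"
      by (simp add: H_def M_def algebra_simps flip: exp_add)
    ultimately show ?thesis by simp
  qed
  have Dpos: "D u > 0" if "u > 0" for u
  proof -
    have "E u > 0" if "u > 0" for u
    proof -
      have "(15 * u + 3) * 1 \<le> (15 * u + 3) * exp (2 * u)"
        using that by (intro mult_left_mono) auto
      then have "E u \<ge> (15 * u + 3) - (u + 3)" by (simp add: E_def)
      then show ?thesis using that by simp
    qed
    then have "H u > 0" if "u > 0" for u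
      using pos[OF z(4) dH _ that] by simp
    then have "D2 u > 0" if "u > 0" for u
      using pos[OF z(3) dD2 _ that] by simp
    then have "D1 u > 0" if "u > 0" for u
      using pos[OF z(2) dD1 _ that] by simp
    then show ?thesis
      using pos[OF z(1) dD _ that] by simp
  qed
  have Dneg: "D u < 0" if "u < 0" for u
  proof -
    have "D2 u < 0" if "u < 0" for u
      using neg[OF z(3) dD2 _ that] Hpos by simp
    then have "D1 u > 0" if "u < 0" for u
      using neg'[OF z(2) dD1 _ that] by simp
    then show ?thesis
      using neg[OF z(1) dD _ that] by simp
  qed
  have DE: "slope_num 0 (3/2) (exp (2 * u)) = D u" for u
  proof -
    have p: "exp (2 * u) powr (3/2) = exp (3 * u)" "exp (2 * u) powr (3/2 - 1) = exp u"
      "exp (2 * u) powr (- 0) = 1" "exp (2 * u) powr (- 0 - 1) = exp (- 2 * u)"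
      "pow_prim 0 (exp (2 * u)) = 2 * u"
      by (simp_all add: powr_def pow_prim_def)
    show ?thesis
      unfolding slope_num_def p D_def by (simp add: algebra_simps power2_eq_square flip: exp_add)
  qed
  define u where "u = ln y / 2"
  have "slope_num 0 (3/2) y = D u"
    using DE[of u] assms by (simp add: u_def)
  moreover have "u > 0 \<and> y > 1 \<or> u < 0 \<and> y < 1"
    using assms by (auto simp: u_def)
  ultimately show ?thesis
    using Dpos[of u] Dneg[of u] by (auto intro: mult_neg_neg)
qed

text \<open>The two extra factors record the sign reversals at \<open>g = 1\<close> and at
  \<open>y = 1\<close>, so that one inequality covers all four cases.\<close>

lemma slope_num_sign:
  assumes "0 \<le> g" "g < 3" "g \<noteq> 1" "al = (3 - g) / 2" "y > 0" "y \<noteq> 1"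
  shows "(1 - g) * ((y - 1) * slope_num g al y) > 0"
proof (cases "g = 0")
  case True
  then have "al = 3 / 2" using assms(4) by simp
  then show ?thesis using slope_num_zero_sign[OF assms(5,6)] True by (simp only:) simp
next
  case False
  define u where "u = ln y / 2"
  define c where "c = exp (- 2 * g * u) / (2 * g\<^sup>2)"
  have c: "c > 0" using False by (simp add: c_def)
  have E: "slope_num g al y = c * expsum (slope_terms g) u"
    using slope_num_expsum[OF False assms(4), of u] assms(5) by (simp add: u_def c_def)
  have u: "u > 0 \<and> y > 1 \<or> u < 0 \<and> y < 1"
    using assms(5,6) by (auto simp: u_def)
  have "(1 - g) * ((y - 1) * expsum (slope_terms g) u) > 0"
  proof (cases "g < 1")
    case True
    have "(y - 1) * expsum (slope_terms g) u > 0"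
      using u slope_terms_pos_lt1[of g u] assms(1) False True
      by (metis diff_gt_0_iff_gt diff_less_0_iff_less mult_neg_neg mult_pos_pos order_le_imp_less_or_eq)
    then show ?thesis using True by simp
  next
    case gt: False
    have "(y - 1) * expsum (slope_terms g) u < 0"
      using u slope_terms_neg_gt1[of g u] assms(2,3) gt
      by (metis diff_gt_0_iff_gt diff_less_0_iff_less mult_neg_pos mult_pos_neg linorder_neqE_linordered_idom)
    then show ?thesis using gt assms(3) by (intro mult_neg_neg) simp_all
  qed
  then have "c * ((1 - g) * ((y - 1) * expsum (slope_terms g) u)) > 0"
    using c by simp
  then show ?thesis by (simp add: E algebra_simps)
qed

section \<open>The normalised period integrand\<close>

text \<open>Both exponents depend on \<open>p / q\<close> alone:
  \<open>g = - 3 * p / (2 * q - p)\<close> and \<open>al = 3 * q / (2 * q - p)\<close>. The range of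
  \<open>g\<close> corresponds to \<open>p <= 0\<close>, and the threshold \<open>g = 1\<close> to
  \<open>- p = q\<close>.\<close>

locale period_exponents =
  fixes g al :: real
  assumes g_bounds: "0 \<le> g" "g < 3" and al_eq: "al = (3 - g) / 2"
begin

lemma al_bounds: "0 < al" "al < 2"
  using g_bounds al_eq by auto

lemma slope_num_al_sign:
  assumes "g \<noteq> 1" "y > 0" "y \<noteq> 1"
  shows "(y - 1) * ((al - 1) * slope_num g al y) > 0"
proof -
  have "2 * ((y - 1) * ((al - 1) * slope_num g al y)) = (1 - g) * ((y - 1) * slope_num g al y)"
    by (simp add: al_eq field_simps)
  then show ?thesis using slope_num_sign[OF g_bounds assms(1) al_eq assms(2,3)] by linarith
qed

text \<open>A difference quotient at \<open>y = 1\<close>, where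
  \<open>(y powr al - 1) / pow_prim g y\<close> has the limit \<open>al\<close>.\<close>

definition h :: "real \<Rightarrow> real" where
  "h y = ((y powr al - 1) / pow_prim g y - al) / (y - 1)"

lemma pow_prim_nz: "y > 0 \<Longrightarrow> y \<noteq> 1 \<Longrightarrow> pow_prim g y \<noteq> 0"
  using pow_prim_less[of y 1 g] pow_prim_less[of 1 y g] by (cases "y < 1") auto

lemma h_deriv:
  assumes "y > 0" "y \<noteq> 1"
  shows "(h has_real_derivative slope_num g al y / (pow_prim g y * (y - 1))\<^sup>2) (at y)"
proof -
  note nz = pow_prim_nz[OF assms]
  have "(h has_real_derivative
      (((al * y powr (al - 1)) * pow_prim g y - (y powr al - 1) * y powr (- g - 1)) / (pow_prim g y * pow_prim g y) * (y - 1)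
        - ((y powr al - 1) / pow_prim g y - al)) / ((y - 1) * (y - 1))) (at y)"
    unfolding h_def[abs_def] using assms nz
    by (auto intro!: derivative_eq_intros pow_prim_deriv)
  then show ?thesis
  proof (rule DERIV_cong)
    have 1: "y powr (al - 1) = y powr al / y" "y powr (- g - 1) = y powr (- g) / y"
      using assms by (simp_all add: powr_diff)
    show "(((al * y powr (al - 1)) * pow_prim g y - (y powr al - 1) * y powr (- g - 1)) / (pow_prim g y * pow_prim g y) * (y - 1)
        - ((y powr al - 1) / pow_prim g y - al)) / ((y - 1) * (y - 1)) = slope_num g al y / (pow_prim g y * (y - 1))\<^sup>2"
      unfolding 1 slope_num_def using assms nz
      by (simp add: divide_simps power2_eq_square, simp add: algebra_simps)
  qed
qed

section \<open>Interpolation of \<open>w powr al\<close> at the two ends\<close>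

definition Q :: "real \<Rightarrow> real" where
  "Q t = ((t + 1) powr al - (t - 1) powr al) / (pow_prim g (t + 1) - pow_prim g (t - 1))"

text \<open>\<open>P t + Q t * pow_prim g w\<close> is the combination of 1 and
  \<open>pow_prim g\<close> that agrees with \<open>w powr al\<close> at \<open>w = t - 1\<close>
  and \<open>w = t + 1\<close>.\<close>

definition P :: "real \<Rightarrow> real" where
  "P t = (t + 1) powr al - Q t * pow_prim g (t + 1)"

definition dQ :: "real \<Rightarrow> real" where
  "dQ t = (al * ((t + 1) powr (al - 1) - (t - 1) powr (al - 1)) * (pow_prim g (t + 1) - pow_prim g (t - 1))
      - ((t + 1) powr al - (t - 1) powr al) * ((t + 1) powr (- g - 1) - (t - 1) powr (- g - 1)))
     / (pow_prim g (t + 1) - pow_prim g (t - 1))\<^sup>2"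

definition dP :: "real \<Rightarrow> real" where
  "dP t = al * (t + 1) powr (al - 1) - (dQ t * pow_prim g (t + 1) + Q t * (t + 1) powr (- g - 1))"

lemma pow_prim_diff_pos: "t > 1 \<Longrightarrow> pow_prim g (t + 1) - pow_prim g (t - 1) > 0"
  using pow_prim_less[of "t - 1" "t + 1" g] by simp

lemma Q_pos: "t > 1 \<Longrightarrow> Q t > 0"
  unfolding Q_def using pow_prim_diff_pos[of t] al_bounds
  by (intro divide_pos_pos) (auto intro: powr_less_mono2)

lemma Q_deriv:
  assumes "t > 1"
  shows "(Q has_real_derivative dQ t) (at t)"
  unfolding Q_def[abs_def] dQ_def using assms pow_prim_diff_pos[OF assms]
  by (auto intro!: derivative_eq_intros DERIV_chain2[OF pow_prim_deriv] simp: power2_eq_square algebra_simps)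

lemma P_deriv:
  assumes "t > 1"
  shows "(P has_real_derivative dP t) (at t)"
  unfolding P_def[abs_def] dP_def using assms
  by (auto intro!: derivative_eq_intros DERIV_chain2[OF pow_prim_deriv] Q_deriv simp: algebra_simps)

text \<open>The interpolation error at \<open>w = t + z\<close>, which is \<open>w powr al\<close>
  times \<open>K - 1\<close>.\<close>

definition k :: "real \<Rightarrow> real \<Rightarrow> real" where
  "k t z = P t + Q t * pow_prim g (t + z) - (t + z) powr al"

definition kt :: "real \<Rightarrow> real \<Rightarrow> real" where
  "kt t z = dP t + dQ t * pow_prim g (t + z) + Q t * (t + z) powr (- g - 1) - al * (t + z) powr (al - 1)"

lemma k_deriv_t:
  assumes "t > 1" "z \<ge> -1"
  shows "((\<lambda>s. k s z) has_real_derivative kt t z) (at t)"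
  unfolding k_def kt_def using assms
  by (auto intro!: derivative_eq_intros DERIV_chain2[OF pow_prim_deriv] Q_deriv P_deriv simp: algebra_simps)

lemma k_ends:
  assumes "t > 1"
  shows "k t 1 = 0" "k t (- 1) = 0"
proof -
  show "k t 1 = 0" by (simp add: k_def P_def)
  have "Q t * (pow_prim g (t + 1) - pow_prim g (t - 1)) = (t + 1) powr al - (t - 1) powr al"
    using pow_prim_diff_pos[OF assms] by (simp add: Q_def)
  then show "k t (- 1) = 0" by (simp add: k_def P_def algebra_simps)
qed

text \<open>The zeros of \<open>k\<close> at both ends persist for every \<open>t > 1\<close>, hence
  survive differentiation in \<open>t\<close>.\<close>

lemma kt_ends:
  assumes "t > 1"
  shows "kt t 1 = 0" "kt t (- 1) = 0"
proof -
  have "kt t z = 0" if z: "z = 1 \<or> z = - 1" for z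
  proof (rule DERIV_unique)
    show "((\<lambda>s. k s z) has_real_derivative kt t z) (at t)"
      using z assms by (intro k_deriv_t) auto
    show "((\<lambda>s. k s z) has_real_derivative 0) (at t)"
    proof (rule has_field_derivative_transform_within_open[of "\<lambda>_. 0" _ _ "{1<..}"])
      show "\<And>s. s \<in> {1<..} \<Longrightarrow> 0 = k s z" using z k_ends by auto
    qed (use assms in auto)
  qed
  then show "kt t 1 = 0" "kt t (- 1) = 0" by auto
qed

section \<open>Slopes at the two ends\<close>

lemma ratio_scale:
  assumes "0 < b" "0 < c" "b \<noteq> c"
  shows "(c powr al - b powr al) / (pow_prim g c - pow_prim g b) * b powr (al - 2) - al * b
     = b * (((c / b) powr al - 1) / pow_prim g (c / b) - al)"
proof -
  have "pow_prim g c - pow_prim g b = b powr (- g) * pow_prim g (c / b)"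
    using pow_prim_scale[of b "c / b" g] assms by simp
  moreover have "c powr al - b powr al = b powr al * ((c / b) powr al - 1)"
    using assms by (simp add: powr_divide field_simps)
  moreover have "pow_prim g (c / b) \<noteq> 0" using assms by (intro pow_prim_nz) auto
  \<comment> \<open>Here \<open>2 * al - 2 = 1 - g\<close> enters: it makes the scaling exponents
    match, so that only the ratio \<open>c / b\<close> and one factor \<open>b\<close> are
    left.\<close>
  moreover have "b powr al * b powr (al - 2) = b * b powr (- g)"
  proof -
    have "b powr al * b powr (al - 2) = b powr (1 + - g)"
      by (simp add: al_eq flip: powr_add)
    then show ?thesis using assms powr_add[of b 1 "- g"] by simp
  qed
  ultimately show ?thesis
    using assms by (simp add: field_simps)
qed

lemma boundary_slope_minus:
  assumes "t > 1" "g \<noteq> 1"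
  shows "(al - 1) * (dQ t * (t - 1) powr (al - 2) + (al - 2) * Q t * (t - 1) powr (al - 3) - al) < 0"
proof -
  \<comment> \<open>The expression to be estimated is the derivative of \<open>N\<close>. By
    homogeneity \<open>N\<close> is \<open>(s - 1) * (y - 1) = 2\<close> times \<open>h\<close> at
    the ratio \<open>y\<close> of the ends, and this ratio decreases in \<open>s\<close>.\<close>
  define N where "N = (\<lambda>s. Q s * (s - 1) powr (al - 2) - al * (s - 1))"
  define y where "y = (t + 1) / (t - 1)"
  have y: "y > 1" "pow_prim g y * (y - 1) \<noteq> 0" using assms pow_prim_nz[of y] by (auto simp: y_def field_simps)
  have 1: "(N has_real_derivative dQ t * (t - 1) powr (al - 2) + (al - 2) * Q t * (t - 1) powr (al - 3) - al) (at t)"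
    unfolding N_def using assms by (auto intro!: derivative_eq_intros Q_deriv simp: algebra_simps)
  have N: "N s = 2 * h ((s + 1) / (s - 1))" if "s > 1" for s
  proof -
    have "N s = (s - 1) * ((((s + 1) / (s - 1)) powr al - 1) / pow_prim g ((s + 1) / (s - 1)) - al)"
      using ratio_scale[of "s - 1" "s + 1"] that by (simp add: N_def Q_def)
    moreover have "(s + 1) / (s - 1) - 1 = 2 / (s - 1)" using that by (simp add: field_simps)
    ultimately show ?thesis by (simp add: h_def)
  qed
  have 2: "((\<lambda>s. 2 * h ((s + 1) / (s - 1))) has_real_derivative
      2 * (slope_num g al y / (pow_prim g y * (y - 1))\<^sup>2 * (- 2 / (t - 1)\<^sup>2))) (at t)"
  proof -
    have dy: "((\<lambda>s. (s + 1) / (s - 1)) has_real_derivative - 2 / (t - 1)\<^sup>2) (at t)"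
      using assms by (auto intro!: derivative_eq_intros simp: power2_eq_square field_simps)
    have hy: "(h has_real_derivative slope_num g al y / (pow_prim g y * (y - 1))\<^sup>2) (at ((t + 1) / (t - 1)))"
      using h_deriv[of y] y by (simp flip: y_def)
    show ?thesis using DERIV_cmult[OF DERIV_chain2[OF hy dy], of "2"] .
  qed
  have 3: "(N has_real_derivative 2 * (slope_num g al y / (pow_prim g y * (y - 1))\<^sup>2 * (- 2 / (t - 1)\<^sup>2))) (at t)"
    by (rule has_field_derivative_transform_within_open[OF 2, of "{1<..}"]) (use assms N in auto)
  have "(al - 1) * slope_num g al y > 0"
    using slope_num_al_sign[OF assms(2), of y] y mult_nonneg_nonpos[of "y - 1" "(al - 1) * slope_num g al y"]
    by linarith
  then have "(al - 1) * (2 * (slope_num g al y / (pow_prim g y * (y - 1))\<^sup>2 * (- 2 / (t - 1)\<^sup>2))) < 0"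
    using y(2) assms(1) by (simp add: divide_simps mult_less_0_iff zero_less_mult_iff)
  then show ?thesis using DERIV_unique[OF 1 3] by simp
qed

lemma boundary_slope_plus:
  assumes "t > 1" "g \<noteq> 1"
  shows "(al - 1) * (dQ t * (t + 1) powr (al - 2) + (al - 2) * Q t * (t + 1) powr (al - 3) - al) > 0"
proof -
  \<comment> \<open>With the ratio inverted, \<open>(s + 1) * (y - 1) = - 2\<close>; moreover
    \<open>y\<close> increases in \<open>s\<close> and lies below 1. Three signs differ from the
    other end, so the result is reversed.\<close>
  define N where "N = (\<lambda>s. Q s * (s + 1) powr (al - 2) - al * (s + 1))"
  define y where "y = (t - 1) / (t + 1)"
  have y: "0 < y" "y < 1" "pow_prim g y * (y - 1) \<noteq> 0" using assms pow_prim_nz[of y] by (auto simp: y_def field_simps)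
  have 1: "(N has_real_derivative dQ t * (t + 1) powr (al - 2) + (al - 2) * Q t * (t + 1) powr (al - 3) - al) (at t)"
    unfolding N_def using assms by (auto intro!: derivative_eq_intros Q_deriv simp: algebra_simps)
  have N: "N s = - 2 * h ((s - 1) / (s + 1))" if "s > 1" for s
  proof -
    have "Q s = ((s - 1) powr al - (s + 1) powr al) / (pow_prim g (s - 1) - pow_prim g (s + 1))"
      unfolding Q_def by (metis minus_diff_eq minus_divide_divide)
    then have "N s = (s + 1) * ((((s - 1) / (s + 1)) powr al - 1) / pow_prim g ((s - 1) / (s + 1)) - al)"
      using ratio_scale[of "s + 1" "s - 1"] that by (simp add: N_def)
    moreover have "(s - 1) / (s + 1) - 1 = - 2 / (s + 1)" using that by (simp add: field_simps)
    ultimately show ?thesis by (simp add: h_def)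
  qed
  have 2: "((\<lambda>s. - 2 * h ((s - 1) / (s + 1))) has_real_derivative
      - 2 * (slope_num g al y / (pow_prim g y * (y - 1))\<^sup>2 * (2 / (t + 1)\<^sup>2))) (at t)"
  proof -
    have dy: "((\<lambda>s. (s - 1) / (s + 1)) has_real_derivative 2 / (t + 1)\<^sup>2) (at t)"
      using assms by (auto intro!: derivative_eq_intros simp: power2_eq_square field_simps)
    have hy: "(h has_real_derivative slope_num g al y / (pow_prim g y * (y - 1))\<^sup>2) (at ((t - 1) / (t + 1)))"
      using h_deriv[of y] y by (simp flip: y_def)
    show ?thesis using DERIV_cmult[OF DERIV_chain2[OF hy dy], of "- 2"] .
  qed
  have 3: "(N has_real_derivative - 2 * (slope_num g al y / (pow_prim g y * (y - 1))\<^sup>2 * (2 / (t + 1)\<^sup>2))) (at t)"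
    by (rule has_field_derivative_transform_within_open[OF 2, of "{1<..}"]) (use assms N in auto)
  have "(al - 1) * slope_num g al y < 0"
    using slope_num_al_sign[OF assms(2), of y] y mult_nonpos_nonneg[of "y - 1" "(al - 1) * slope_num g al y"]
    by linarith
  then have "(al - 1) * (- 2 * (slope_num g al y / (pow_prim g y * (y - 1))\<^sup>2 * (2 / (t + 1)\<^sup>2))) > 0"
    using y(3) assms(1) by (simp add: divide_simps mult_less_0_iff zero_less_mult_iff)
  then show ?thesis using DERIV_unique[OF 1 3] by simp
qed

text \<open>For \<open>q = 2\<close> one has \<open>J = w powr (2 - al) * k\<close> with
  \<open>w = t + z\<close>, and the expression in \<open>k\<close> and \<open>kt\<close> is
  \<open>w powr (al - 1)\<close> times the derivative of \<open>J\<close> in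
  \<open>t\<close>.\<close>

lemma key_sign:
  assumes "t > 1" "g \<noteq> 1" "- 1 < z" "z < 1"
  shows "(al - 1) * ((2 - al) * k t z + (t + z) * kt t z) < 0"
proof -
  define F where "F = (\<lambda>w. (2 - al) * (P t + Q t * pow_prim g w) + (dP t + dQ t * pow_prim g w) * w
     + Q t * w powr (- g) - 2 * w powr al)"
  define F1 where "F1 = (\<lambda>w. (al - 1) * Q t * w powr (- g - 1) + dP t + dQ t * pow_prim g w
     + dQ t * w powr (- g) - 2 * al * w powr (al - 1))"
  \<comment> \<open>\<open>r\<close> is the rest of the second derivative of \<open>F\<close> after
    a power of \<open>w\<close> and the factor \<open>al - 1\<close> are removed; the factor comes
    out because \<open>1 - g = 2 * (al - 1)\<close>. Multiplying \<open>F\<close> by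
    \<open>al - 1\<close> turns it into a square, so both signs of \<open>al - 1\<close> are treated
    at once.\<close>
  define r where "r = (\<lambda>w. 2 * dQ t - (g + 1) * Q t / w - 2 * al * w powr (al + g - 1))"
  define f f1 where "f = (\<lambda>w. (al - 1) * F w)" and "f1 = (\<lambda>w. (al - 1) * F1 w)"
  define b a where "b = t - 1" and "a = t + 1"
  have ba: "0 < b" "b < a" using assms by (auto simp: a_def b_def)
  have F_eq: "F w = (2 - al) * k t (w - t) + w * kt t (w - t)" if "w > 0" for w
  proof -
    have e: "w powr (- g) = w * w powr (- g - 1)" "w powr al = w * w powr (al - 1)"
      using that by (simp_all add: powr_diff)
    have w: "t + (w - t) = w" by simp
    show ?thesis
      unfolding F_def k_def kt_def w e by (simp add: algebra_simps)
  qed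
  have dF: "(F has_real_derivative F1 w) (at w)" if "w > 0" for w
  proof -
    have "(F has_real_derivative (2 - al) * (Q t * w powr (- g - 1)) + (dQ t * w powr (- g - 1) * w
       + (dP t + dQ t * pow_prim g w)) + Q t * (- g * w powr (- g - 1)) - 2 * (al * w powr (al - 1))) (at w)"
      unfolding F_def using that by (auto intro!: derivative_eq_intros pow_prim_deriv)
    then show ?thesis
    proof (rule DERIV_cong)
      have "w powr (- g - 1) * w = w powr (- g)"
        using that by (simp add: powr_diff)
      moreover have "(2 - al) * (Q t * w powr (- g - 1)) + Q t * (- g * w powr (- g - 1))
          = (al - 1) * Q t * w powr (- g - 1)"
        by (simp add: al_eq field_simps)
      ultimately show "(2 - al) * (Q t * w powr (- g - 1)) + (dQ t * w powr (- g - 1) * w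
         + (dP t + dQ t * pow_prim g w)) + Q t * (- g * w powr (- g - 1)) - 2 * (al * w powr (al - 1)) = F1 w"
        by (simp add: F1_def mult.assoc)
    qed
  qed
  have df: "(f has_real_derivative f1 w) (at w)" if "w > 0" for w
    unfolding f_def f1_def using dF[OF that] by (rule DERIV_cmult)
  have df1: "(f1 has_real_derivative (al - 1)\<^sup>2 * w powr (- g - 1) * r w) (at w)" if "w > 0" for w
  proof -
    have "(f1 has_real_derivative (al - 1) * ((al - 1) * Q t * ((- g - 1) * w powr (- g - 1 - 1))
       + dQ t * w powr (- g - 1) + dQ t * (- g * w powr (- g - 1))
       - 2 * al * ((al - 1) * w powr (al - 1 - 1)))) (at w)"
      unfolding f1_def F1_def using that by (auto intro!: derivative_eq_intros pow_prim_deriv)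
    then show ?thesis
    proof (rule DERIV_cong)
      have 1: "w powr (- g - 1 - 1) = w powr (- g - 1) / w"
        using that powr_diff[of w "- g - 1" 1] by simp
      have 2: "w powr (al - 1 - 1) = w powr (- g - 1) * w powr (al + g - 1)"
        by (simp flip: powr_add)
      show "(al - 1) * ((al - 1) * Q t * ((- g - 1) * w powr (- g - 1 - 1))
         + dQ t * w powr (- g - 1) + dQ t * (- g * w powr (- g - 1))
         - 2 * al * ((al - 1) * w powr (al - 1 - 1))) = (al - 1)\<^sup>2 * w powr (- g - 1) * r w"
      proof -
        have g: "g = 3 - 2 * al" using al_eq by simp
        show ?thesis
          unfolding 1 2 r_def using that
          by (simp add: field_simps power2_eq_square) (simp add: g algebra_simps)
      qed
    qed
  qed
  define r1 where "r1 = (\<lambda>w. (g + 1) * Q t - 2 * al * (2 - al) * w powr (al + g))"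
  have dr: "(r has_real_derivative r1 w / w\<^sup>2) (at w)" if "w > 0" for w
  proof -
    have "(r has_real_derivative (g + 1) * Q t / (w * w) - 2 * al * ((al + g - 1) * w powr (al + g - 1 - 1))) (at w)"
      unfolding r_def using that by (auto intro!: derivative_eq_intros)
    then show ?thesis
    proof (rule DERIV_cong)
      have 1: "w powr (al + g - 1 - 1) = w powr (al + g) / w\<^sup>2"
        using that by (simp add: powr_diff power2_eq_square)
      have 2: "al + g - 1 = 2 - al" by (simp add: al_eq field_simps)
      show "(g + 1) * Q t / (w * w) - 2 * al * ((al + g - 1) * w powr (al + g - 1 - 1)) = r1 w / w\<^sup>2"
        unfolding 1 unfolding 2 r1_def using that by (simp add: field_simps power2_eq_square)
    qed
  qed
  have f1b: "f1 b < 0"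
  proof -
    have "F1 b = b powr (al - 1) * (dQ t * b powr (al - 2) + (al - 2) * Q t * b powr (al - 3) - al)"
    proof -
      have "- g = (al - 1) + (al - 2)" "- g - 1 = (al - 1) + (al - 3)"
        using al_eq by simp_all
      then have e: "b powr (- g) = b powr (al - 1) * b powr (al - 2)"
        "b powr (- g - 1) = b powr (al - 1) * b powr (al - 3)"
        by (simp_all only: powr_add)
      \<comment> \<open>This relation eliminates \<open>dP t\<close> together with
        \<open>pow_prim g b\<close> and leaves the expression of
        \<open>boundary_slope_minus\<close>.\<close>
      have "kt t (- 1) = 0" using kt_ends assms by simp
      then show ?thesis
        unfolding F1_def kt_def using e by (simp add: b_def, algebra)
    qed
    then have "f1 b = b powr (al - 1) * ((al - 1) * (dQ t * b powr (al - 2) + (al - 2) * Q t * b powr (al - 3) - al))"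
      by (simp add: f1_def)
    then show ?thesis
      using boundary_slope_minus[OF assms(1,2)] ba by (simp add: b_def mult_pos_neg)
  qed
  have f1a: "f1 a > 0"
  proof -
    have "F1 a = a powr (al - 1) * (dQ t * a powr (al - 2) + (al - 2) * Q t * a powr (al - 3) - al)"
    proof -
      have "- g = (al - 1) + (al - 2)" "- g - 1 = (al - 1) + (al - 3)"
        using al_eq by simp_all
      then have e: "a powr (- g) = a powr (al - 1) * a powr (al - 2)"
        "a powr (- g - 1) = a powr (al - 1) * a powr (al - 3)"
        by (simp_all only: powr_add)
      have "kt t 1 = 0" using kt_ends assms by simp
      then show ?thesis
        unfolding F1_def kt_def using e by (simp add: a_def, algebra)
    qed
    then have "f1 a = a powr (al - 1) * ((al - 1) * (dQ t * a powr (al - 2) + (al - 2) * Q t * a powr (al - 3) - al))"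
      by (simp add: f1_def)
    then show ?thesis
      using boundary_slope_plus[OF assms(1,2)] ba by (simp add: a_def)
  qed
  have fb: "f b = 0" and fa: "f a = 0"
    using F_eq[of b] F_eq[of a] ba k_ends[OF assms(1)] kt_ends[OF assms(1)]
    by (simp_all add: f_def a_def b_def)
  define w0 where "w0 = t + z"
  have w0: "b < w0" "w0 < a" using assms by (auto simp: w0_def a_def b_def)
  have "f w0 < 0"
  proof (rule ccontr)
    \<comment> \<open>Negative values of \<open>f\<close> near both ends then force the signs -, +,
      -, + of \<open>f1\<close> at \<open>b\<close>, \<open>y1\<close>, \<open>y2\<close>,
      \<open>a\<close>. The mean value theorem yields +, -, + for \<open>r\<close> and -, + for
      \<open>r1\<close>, which contradicts the monotonicity of \<open>r1\<close>.\<close>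
    assume "\<not> f w0 < 0"
    then have fw0: "f w0 \<ge> 0" by simp
    obtain d where d: "d > 0" "\<And>h. 0 < h \<Longrightarrow> h < d \<Longrightarrow> f (b + h) < f b"
      using DERIV_neg_dec_right[OF df f1b] ba by auto
    define b' where "b' = b + min d (w0 - b) / 2"
    have b': "b < b'" "b' < w0" "f b' < 0"
      using d(2)[of "min d (w0 - b) / 2"] d(1) w0 fb unfolding b'_def by (auto simp: min_def field_simps)
    obtain e where e: "e > 0" "\<And>h. 0 < h \<Longrightarrow> h < e \<Longrightarrow> f (a - h) < f a"
      using DERIV_pos_inc_left[OF df f1a] ba by auto
    define a' where "a' = a - min e (a - w0) / 2"
    have a': "w0 < a'" "a' < a" "f a' < 0"
      using e(2)[of "min e (a - w0) / 2"] e(1) w0 fa unfolding a'_def by (auto simp: min_def field_simps)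
    obtain y1 where y1: "b' < y1" "y1 < w0" "f w0 - f b' = (w0 - b') * f1 y1"
      using MVT2[OF b'(2), of f f1] df ba b' by (metis less_le_trans less_trans)
    obtain y2 where y2: "w0 < y2" "y2 < a'" "f a' - f w0 = (a' - w0) * f1 y2"
      using MVT2[OF a'(1), of f f1] df ba b' by (metis less_le_trans less_trans)
    have "(w0 - b') * f1 y1 > 0" using y1(3) fw0 b' by linarith
    then have f1y1: "f1 y1 > 0" using b' by (simp add: zero_less_mult_iff)
    have "(a' - w0) * f1 y2 < 0" using y2(3) fw0 a' by linarith
    then have f1y2: "f1 y2 < 0" using a' by (simp add: mult_less_0_iff)
    have mvt: "\<exists>s>x. s < y \<and> f1 y - f1 x = (y - x) * ((al - 1)\<^sup>2 * s powr (- g - 1) * r s)"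
      if "0 < x" "x < y" for x y
      using MVT2[OF that(2), of f1 "\<lambda>w. (al - 1)\<^sup>2 * w powr (- g - 1) * r w"] df1 that
      by (meson less_le_trans)
    have weight: "(al - 1)\<^sup>2 * s powr (- g - 1) > 0" if "s > 0" for s
      using assms(2) al_eq that by simp
    have cancel_pos: "r s > 0"
      if "0 < d * ((al - 1)\<^sup>2 * s powr (- g - 1) * r s)" "0 < d" "0 < s" for s d
      using zero_less_mult_pos[OF zero_less_mult_pos[OF that(1,2)] weight[OF that(3)]] .
    have cancel_neg: "r s < 0"
      if "d * ((al - 1)\<^sup>2 * s powr (- g - 1) * r s) < 0" "0 < d" "0 < s" for s d
    proof -
      have "0 < d * ((al - 1)\<^sup>2 * s powr (- g - 1) * - r s)" using that(1) by simp
      from zero_less_mult_pos[OF zero_less_mult_pos[OF this that(2)] weight[OF that(3)]]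
      show ?thesis by simp
    qed
    obtain s0 where s0: "b < s0" "s0 < y1" "r s0 > 0"
    proof -
      obtain s where s: "b < s" "s < y1" "f1 y1 - f1 b = (y1 - b) * ((al - 1)\<^sup>2 * s powr (- g - 1) * r s)"
        using mvt[of b y1] ba b' y1 by auto
      then have "0 < (y1 - b) * ((al - 1)\<^sup>2 * s powr (- g - 1) * r s)"
        using f1y1 f1b by linarith
      then have "r s > 0"
        by (rule cancel_pos) (use s(1,2) ba b'(1) y1(1,2) y2(1,2) in linarith)+
      then show thesis using that s by blast
    qed
    obtain s1 where s1: "y1 < s1" "s1 < y2" "r s1 < 0"
    proof -
      obtain s where s: "y1 < s" "s < y2" "f1 y2 - f1 y1 = (y2 - y1) * ((al - 1)\<^sup>2 * s powr (- g - 1) * r s)"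
        using mvt[of y1 y2] ba b' y1 y2 by auto
      then have "(y2 - y1) * ((al - 1)\<^sup>2 * s powr (- g - 1) * r s) < 0"
        using f1y1 f1y2 by linarith
      then have "r s < 0"
        by (rule cancel_neg) (use s(1,2) ba b'(1) y1(1,2) y2(1,2) in linarith)+
      then show thesis using that s by blast
    qed
    obtain s2 where s2: "y2 < s2" "s2 < a" "r s2 > 0"
    proof -
      obtain s where s: "y2 < s" "s < a" "f1 a - f1 y2 = (a - y2) * ((al - 1)\<^sup>2 * s powr (- g - 1) * r s)"
        using mvt[of y2 a] ba b' y1 y2 a' by auto
      then have "0 < (a - y2) * ((al - 1)\<^sup>2 * s powr (- g - 1) * r s)"
        using f1a f1y2 by linarith
      then have "r s > 0"
        by (rule cancel_pos) (use s(1,2) ba b'(1) y1(1,2) y2(1,2) in linarith)+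
      then show thesis using that s by blast
    qed
    have mvtr: "\<exists>s>x. s < y \<and> r y - r x = (y - x) * (r1 s / s\<^sup>2)"
      if "0 < x" "x < y" for x y
      using MVT2[OF that(2), of r "\<lambda>w. r1 w / w\<^sup>2"] dr that by (meson less_le_trans)
    obtain v0 where v0: "s0 < v0" "v0 < s1" "r1 v0 < 0"
    proof -
      obtain s where s: "s0 < s" "s < s1" "r s1 - r s0 = (s1 - s0) * (r1 s / s\<^sup>2)"
        using mvtr[of s0 s1] ba s0 s1 by auto
      then have "(s1 - s0) * (r1 s / s\<^sup>2) < 0" using s0 s1 by linarith
      then have "r1 s < 0" using s by (simp add: mult_less_0_iff divide_less_0_iff)
      then show thesis using that s by blast
    qed
    obtain v1 where v1: "s1 < v1" "v1 < s2" "r1 v1 > 0"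
    proof -
      obtain s where s: "s1 < s" "s < s2" "r s2 - r s1 = (s2 - s1) * (r1 s / s\<^sup>2)"
        using mvtr[of s1 s2] ba s0 s1 s2 by auto
      then have "0 < (s2 - s1) * (r1 s / s\<^sup>2)" using s2 s1 by linarith
      then have "r1 s > 0" using s by (simp add: zero_less_mult_iff zero_less_divide_iff)
      then show thesis using that s by blast
    qed
    have "v0 powr (al + g) \<le> v1 powr (al + g)"
      using v0 v1 s0 ba al_bounds g_bounds by (intro powr_mono2) auto
    then have "2 * al * (2 - al) * v0 powr (al + g) \<le> 2 * al * (2 - al) * v1 powr (al + g)"
      using al_bounds by (intro mult_left_mono) auto
    then show False using v0 v1 by (simp add: r1_def)
  qed
  then show ?thesis
    using F_eq[of w0] w0 ba by (simp add: f_def w0_def)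
qed

end

section \<open>Comparison with a parabola and the sign of the derivative\<close>

text \<open>The weighted condition is concavity of \<open>h\<close> in a variable with derivative
  \<open>1 / psi\<close>. A negative value inside would make \<open>psi * h'\<close> negative first
  and positive later, against its monotonicity.\<close>

lemma weighted_concave_nonneg:
  fixes h h' psi e' :: "real \<Rightarrow> real"
  assumes "h a = 0" "h b = 0"
    and h: "\<And>x. a \<le> x \<Longrightarrow> x \<le> b \<Longrightarrow> (h has_real_derivative h' x) (at x)"
    and e: "\<And>x. a \<le> x \<Longrightarrow> x \<le> b \<Longrightarrow> ((\<lambda>x. psi x * h' x) has_real_derivative e' x) (at x)"
    and e': "\<And>x. a \<le> x \<Longrightarrow> x \<le> b \<Longrightarrow> e' x \<le> 0"
    and psi: "\<And>x. a \<le> x \<Longrightarrow> x \<le> b \<Longrightarrow> psi x > 0"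
    and x: "a \<le> x" "x \<le> b"
  shows "h x \<ge> 0"
proof (rule ccontr)
  assume "\<not> h x \<ge> 0"
  then have neg: "h x < 0" by simp
  then have ax: "a < x" and xb: "x < b"
    using assms(1,2) x by (auto simp: less_le)
  obtain c where c: "a < c" "c < x" "h x - h a = (x - a) * h' c"
    using MVT2[OF ax, of h h'] h xb by auto
  obtain d where d: "x < d" "d < b" "h b - h x = (b - x) * h' d"
    using MVT2[OF xb, of h h'] h ax by auto
  have "h' c < 0"
    using c neg ax assms(1) by (simp add: mult_less_0_iff)
  moreover have "0 < (b - x) * h' d"
    using d(3) neg assms(2) by simp
  then have "h' d > 0"
    using xb by (simp add: zero_less_mult_iff)
  moreover have "psi d * h' d \<le> psi c * h' c"
    by (rule DERIV_nonpos_imp_nonincreasing[of c d "\<lambda>x. psi x * h' x"])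
       (use c d e e' in \<open>force intro!: exI\<close>)+
  ultimately show False
    using psi[of c] psi[of d] c d mult_pos_pos[of "psi d" "h' d"] mult_pos_neg[of "psi c" "h' c"]
    by linarith
qed

text \<open>Both \<open>C * (1 - z^2) - f z\<close> and \<open>C * (1 - z^2) + f z\<close> are
  concave and vanish at the ends.\<close>

lemma abs_le_parabola:
  fixes f f' f'' :: "real \<Rightarrow> real"
  assumes "f (- 1) = 0" "f 1 = 0"
    and f: "\<And>z. - 1 \<le> z \<Longrightarrow> z \<le> 1 \<Longrightarrow> (f has_real_derivative f' z) (at z)"
    and f': "\<And>z. - 1 \<le> z \<Longrightarrow> z \<le> 1 \<Longrightarrow> (f' has_real_derivative f'' z) (at z)"
    and C: "\<And>z. - 1 \<le> z \<Longrightarrow> z \<le> 1 \<Longrightarrow> \<bar>f'' z\<bar> \<le> C"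
    and z: "- 1 \<le> z" "z \<le> 1"
  shows "\<bar>f z\<bar> \<le> C * (1 - z\<^sup>2)"
proof -
  have C0: "C \<ge> 0" using C[of 0] by simp
  have "C * (1 - z\<^sup>2) - \<sigma> * f z \<ge> 0" if s: "\<sigma> = 1 \<or> \<sigma> = - 1" for \<sigma>
  proof (rule weighted_concave_nonneg[of "\<lambda>z. C * (1 - z\<^sup>2) - \<sigma> * f z" "- 1" 1
        "\<lambda>z. - 2 * C * z - \<sigma> * f' z" "\<lambda>_. 1" "\<lambda>z. - 2 * C - \<sigma> * f'' z"])
    show "- 2 * C - \<sigma> * f'' x \<le> 0" if "- 1 \<le> x" "x \<le> 1" for x
      using C[OF that] s C0 by auto
  qed (use assms s in \<open>auto intro!: derivative_eq_intros simp: algebra_simps\<close>)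
  from this[of 1] this[of "- 1"] show ?thesis by auto
qed

lemma compact_pos_lower:
  fixes f :: "'a::topological_space \<Rightarrow> real"
  assumes "compact B" "continuous_on B f" "\<And>x. x \<in> B \<Longrightarrow> f x > 0"
  obtains c where "c > 0" "\<And>x. x \<in> B \<Longrightarrow> c \<le> f x"
proof (cases "B = {}")
  case True
  then show ?thesis using that[of 1] by simp
next
  case False
  then show ?thesis using continuous_attains_inf[OF assms(1) False assms(2)] assms(3) that by metis
qed

lemma compact_abs_bound:
  fixes f :: "'a::topological_space \<Rightarrow> real"
  assumes "compact B" "continuous_on B f"
  obtains C where "C > 0" "\<And>x. x \<in> B \<Longrightarrow> \<bar>f x\<bar> \<le> C"
proof -
  have "bounded (f ` B)"
    using compact_continuous_image[OF assms(2,1)] by (rule compact_imp_bounded)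
  then obtain C where "C > 0" "\<forall>x\<in>B. norm (f x) \<le> C"
    unfolding bounded_pos by auto
  then show ?thesis using that[of C] by simp
qed

context period_exponents
begin

section \<open>Comparison of \<open>k\<close> and \<open>kt\<close> with the parabola, locally
  uniformly in \<open>t\<close>\<close>

definition kz :: "real \<Rightarrow> real \<Rightarrow> real" where
  "kz t z = Q t * (t + z) powr (- g - 1) - al * (t + z) powr (al - 1)"

definition kzz :: "real \<Rightarrow> real \<Rightarrow> real" where
  "kzz t z = - (g + 1) * Q t * (t + z) powr (- g - 2) - al * (al - 1) * (t + z) powr (al - 2)"

definition ktz :: "real \<Rightarrow> real \<Rightarrow> real" where
  "ktz t z = dQ t * (t + z) powr (- g - 1) - (g + 1) * Q t * (t + z) powr (- g - 2)
     - al * (al - 1) * (t + z) powr (al - 2)"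

definition ktzz :: "real \<Rightarrow> real \<Rightarrow> real" where
  "ktzz t z = - (g + 1) * dQ t * (t + z) powr (- g - 2) + (g + 1) * (g + 2) * Q t * (t + z) powr (- g - 3)
     - al * (al - 1) * (al - 2) * (t + z) powr (al - 3)"

lemma z_derivs:
  assumes "t + z > 0"
  shows "(k t has_real_derivative kz t z) (at z)"
    and "(kz t has_real_derivative kzz t z) (at z)"
    and "(kt t has_real_derivative ktz t z) (at z)"
    and "(ktz t has_real_derivative ktzz t z) (at z)"
  unfolding k_def[abs_def] kz_def[abs_def] kzz_def kt_def[abs_def] ktz_def[abs_def] ktzz_def using assms
  by (auto intro!: derivative_eq_intros DERIV_chain2[OF pow_prim_deriv] simp: algebra_simps)

lemma Q_cont: "continuous_on {1<..} Q"
  by (rule DERIV_continuous_on) (rule has_field_derivative_at_within, rule Q_deriv, simp)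

lemma pow_prim_cont: "continuous_on {0<..} (pow_prim g)"
  by (rule DERIV_continuous_on) (rule has_field_derivative_at_within, rule pow_prim_deriv, simp)

lemma pow_prim_cont' [continuous_intros]:
  "continuous_on S f \<Longrightarrow> (\<And>x. x \<in> S \<Longrightarrow> f x > 0) \<Longrightarrow> continuous_on S (\<lambda>x. pow_prim g (f x))"
  by (rule continuous_on_compose2[OF pow_prim_cont]) auto

lemma Q_cont' [continuous_intros]:
  "continuous_on S f \<Longrightarrow> (\<And>x. x \<in> S \<Longrightarrow> f x > 1) \<Longrightarrow> continuous_on S (\<lambda>x. Q (f x))"
  by (rule continuous_on_compose2[OF Q_cont]) auto

lemma dQ_cont: "continuous_on {1<..} dQ"
proof -
  have "(pow_prim g (t + 1) - pow_prim g (t - 1))\<^sup>2 \<noteq> 0" if "t \<in> {1<..}" for t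
    using pow_prim_diff_pos[of t] that by simp
  then show ?thesis
    unfolding dQ_def[abs_def] by (intro continuous_intros) auto
qed

lemma dQ_cont' [continuous_intros]:
  "continuous_on S f \<Longrightarrow> (\<And>x. x \<in> S \<Longrightarrow> f x > 1) \<Longrightarrow> continuous_on S (\<lambda>x. dQ (f x))"
  by (rule continuous_on_compose2[OF dQ_cont]) auto

lemma P_cont: "continuous_on {1<..} P"
  by (rule DERIV_continuous_on) (rule has_field_derivative_at_within, rule P_deriv, simp)

lemma P_cont' [continuous_intros]:
  "continuous_on S f \<Longrightarrow> (\<And>x. x \<in> S \<Longrightarrow> f x > 1) \<Longrightarrow> continuous_on S (\<lambda>x. P (f x))"
  by (rule continuous_on_compose2[OF P_cont]) auto

lemma k_lower:
  assumes "1 < t0"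
  obtains c where "c > 0" "\<And>t z. t \<in> {t0..t1} \<Longrightarrow> - 1 \<le> z \<Longrightarrow> z \<le> 1 \<Longrightarrow> c * (1 - z\<^sup>2) \<le> k t z"
proof -
  let ?B = "{t0..t1} \<times> {- 1..1::real}"
  \<comment> \<open>The weight \<open>(t + z) powr (1 - al)\<close> makes the contribution of
    \<open>w powr al\<close> to the weighted slope of \<open>k\<close> constant. What remains has
    derivative \<open>- U\<close>, strictly negative on the rectangle. \<open>V\<close> is the
    derivative of the weight times \<open>2 * z\<close>, the contribution of the parabola.\<close>
  define U where "U = (\<lambda>(t, z). (g + al) * Q t * (t + z) powr (- g - al - 1))"
  define V where "V = (\<lambda>(t, z). 2 * ((t + z) powr (1 - al) + z * (1 - al) * (t + z) powr (- al)))"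
  have B: "compact ?B" by (intro compact_Times compact_Icc)
  have cU: "continuous_on ?B U" and cV: "continuous_on ?B V"
    unfolding U_def V_def case_prod_unfold using assms
    by (intro continuous_intros; force)+
  have "U x > 0" if "x \<in> ?B" for x
  proof -
    have "g + al > 0" "fst x > 1" "fst x + snd x > 0"
      using that assms al_bounds g_bounds by auto
    then show ?thesis unfolding U_def case_prod_unfold by (intro mult_pos_pos Q_pos) auto
  qed
  then obtain u where u: "u > 0" "\<And>x. x \<in> ?B \<Longrightarrow> u \<le> U x"
    using compact_pos_lower[OF B cU] by blast
  obtain v where v: "v > 0" "\<And>x. x \<in> ?B \<Longrightarrow> \<bar>V x\<bar> \<le> v"
    using compact_abs_bound[OF B cV] by blast
  \<comment> \<open>Chosen so that \<open>c * V <= c * v = u <= U\<close> on the rectangle.\<close>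
  define c where "c = u / v"
  have c: "c > 0" using u v by (simp add: c_def)
  moreover have "c * (1 - z\<^sup>2) \<le> k t z" if t: "t \<in> {t0..t1}" and z: "- 1 \<le> z" "z \<le> 1" for t z
  proof -
    have "k t z - c * (1 - z\<^sup>2) \<ge> 0"
    proof (rule weighted_concave_nonneg[of "\<lambda>z. k t z - c * (1 - z\<^sup>2)" "- 1" 1
          "\<lambda>z. kz t z + 2 * c * z" "\<lambda>z. (t + z) powr (1 - al)" "\<lambda>z. - U (t, z) + c * V (t, z)", OF _ _ _ _ _ _ z])
      fix x :: real assume x: "- 1 \<le> x" "x \<le> 1"
      have w: "t + x > 0" using t x assms by auto
      then show "(t + x) powr (1 - al) > 0" by simp
      show "((\<lambda>z. k t z - c * (1 - z\<^sup>2)) has_real_derivative kz t x + 2 * c * x) (at x)"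
        using w by (auto intro!: derivative_eq_intros z_derivs)
      have "((\<lambda>z. (t + z) powr (1 - al) * (kz t z + 2 * c * z)) has_real_derivative
          (1 - al) * (t + x) powr (- al) * (kz t x + 2 * c * x) + (t + x) powr (1 - al) * (kzz t x + 2 * c)) (at x)"
        using w by (auto intro!: derivative_eq_intros z_derivs)
      then show "((\<lambda>z. (t + z) powr (1 - al) * (kz t z + 2 * c * z)) has_real_derivative
          - U (t, x) + c * V (t, x)) (at x)"
      proof (rule DERIV_cong)
        have e: "(t + x) powr (- al) * (t + x) powr (- g - 1) = (t + x) powr (- g - al - 1)"
           "(t + x) powr (1 - al) * (t + x) powr (- g - 2) = (t + x) powr (- g - al - 1)"
           "(t + x) powr (- al) * (t + x) powr (al - 1) = (t + x) powr (- 1)"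
           "(t + x) powr (1 - al) * (t + x) powr (al - 2) = (t + x) powr (- 1)"
          by (subst powr_add[symmetric], rule arg_cong[where f = "\<lambda>e. (t + x) powr e"], simp)+
        have expand: "(1 - al) * pa * (q * q1 - al * r1 + 2 * c * x)
            + pb * (- (g + 1) * q * q2 - al * (al - 1) * r2 + 2 * c)
            = - ((g + al) * q * s) + c * (2 * (pb + x * (1 - al) * pa))"
          if "pa * q1 = s" "pb * q2 = s" "pa * r1 = i" "pb * r2 = i" for pa pb q q1 q2 r1 r2 s i :: real
        proof -
          have "(1 - al) * pa * (q * q1 - al * r1 + 2 * c * x)
            + pb * (- (g + 1) * q * q2 - al * (al - 1) * r2 + 2 * c)
            = (1 - al) * q * (pa * q1) - (1 - al) * al * (pa * r1) + (1 - al) * 2 * c * x * pa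
              - (g + 1) * q * (pb * q2) - al * (al - 1) * (pb * r2) + 2 * c * pb"
            by (simp add: algebra_simps)
          then show ?thesis unfolding that by (simp add: algebra_simps)
        qed
        show "(1 - al) * (t + x) powr (- al) * (kz t x + 2 * c * x) + (t + x) powr (1 - al) * (kzz t x + 2 * c)
            = - U (t, x) + c * V (t, x)"
          unfolding U_def V_def kz_def kzz_def prod.case by (rule expand) (fact e)+
      qed
      have tx: "(t, x) \<in> ?B" using t x by simp
      have "c * V (t, x) \<le> c * v"
        using v(2)[OF tx] c by (intro mult_left_mono) auto
      also have "\<dots> = u" using v(1) by (simp add: c_def)
      also have "\<dots> \<le> U (t, x)" using u(2)[OF tx] .
      finally show "- U (t, x) + c * V (t, x) \<le> 0" by simp
    qed (use k_ends[of t] t assms in auto)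
    then show ?thesis by simp
  qed
  ultimately show ?thesis using that by blast
qed

text \<open>Both functions vanish at \<open>z = -1\<close> and \<open>z = 1\<close>, and their
  second derivatives in \<open>z\<close> are bounded on the compact rectangle.\<close>

lemma k_kt_upper:
  assumes "1 < t0"
  obtains C where "C > 0"
    "\<And>t z. t \<in> {t0..t1} \<Longrightarrow> - 1 \<le> z \<Longrightarrow> z \<le> 1 \<Longrightarrow> \<bar>k t z\<bar> \<le> C * (1 - z\<^sup>2)"
    "\<And>t z. t \<in> {t0..t1} \<Longrightarrow> - 1 \<le> z \<Longrightarrow> z \<le> 1 \<Longrightarrow> \<bar>kt t z\<bar> \<le> C * (1 - z\<^sup>2)"
proof -
  let ?B = "{t0..t1} \<times> {- 1..1::real}"
  have B: "compact ?B" by (intro compact_Times compact_Icc)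
  have c: "continuous_on ?B (\<lambda>(t, z). kzz t z)" "continuous_on ?B (\<lambda>(t, z). ktzz t z)"
    unfolding kzz_def ktzz_def case_prod_unfold using assms by (intro continuous_intros; force)+
  obtain C1 where C1: "C1 > 0" "\<And>x. x \<in> ?B \<Longrightarrow> \<bar>case_prod kzz x\<bar> \<le> C1"
    using compact_abs_bound[OF B c(1)] by blast
  obtain C2 where C2: "C2 > 0" "\<And>x. x \<in> ?B \<Longrightarrow> \<bar>case_prod ktzz x\<bar> \<le> C2"
    using compact_abs_bound[OF B c(2)] by blast
  show ?thesis
  proof (rule that[of "max C1 C2"])
    show "max C1 C2 > 0" using C1(1) by simp
    fix t z :: real assume t: "t \<in> {t0..t1}" and z: "- 1 \<le> z" "z \<le> 1"
    have "\<bar>kzz t x\<bar> \<le> max C1 C2" "\<bar>ktzz t x\<bar> \<le> max C1 C2" if "- 1 \<le> x" "x \<le> 1" for x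
      using C1(2)[of "(t, x)"] C2(2)[of "(t, x)"] t that by auto
    then show "\<bar>k t z\<bar> \<le> max C1 C2 * (1 - z\<^sup>2)" "\<bar>kt t z\<bar> \<le> max C1 C2 * (1 - z\<^sup>2)"
      using t z assms k_ends[of t] kt_ends[of t]
      by (auto intro!: abs_le_parabola[of "k t" "kz t" "kzz t"] abs_le_parabola[of "kt t" "ktz t" "ktzz t"] z_derivs)
  qed
qed

lemma k_pos:
  assumes "t > 1" "- 1 < z" "z < 1"
  shows "k t z > 0"
proof -
  obtain c where "c > 0" "c * (1 - z\<^sup>2) \<le> k t z"
    using k_lower[of t t] assms by (metis atLeastAtMost_singleton less_imp_le singletonI)
  moreover have "1 - z\<^sup>2 > 0"
    using assms by (simp add: abs_square_less_1 abs_less_iff)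
  ultimately show ?thesis using mult_pos_pos[of c "1 - z\<^sup>2"] by linarith
qed

section \<open>The function \<open>J\<close> and its derivative in \<open>t\<close>\<close>

definition K :: "real \<Rightarrow> real \<Rightarrow> real" where
  "K t z = 1 + (t + z) powr (- al) * k t z"

definition Kt :: "real \<Rightarrow> real \<Rightarrow> real" where
  "Kt t z = (t + z) powr (- al) * kt t z - al * (t + z) powr (- al - 1) * k t z"

text \<open>\<open>m\<close> stands for \<open>2 / q\<close>, so \<open>q <= 2\<close> becomes
  \<open>m >= 1\<close> and \<open>q = 2\<close> is the linear case.\<close>

definition J :: "real \<Rightarrow> real \<Rightarrow> real \<Rightarrow> real" where
  "J m t z = (t + z)\<^sup>2 * (K t z powr m - 1)"

definition dJ :: "real \<Rightarrow> real \<Rightarrow> real \<Rightarrow> real" where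
  "dJ m t z = 2 * (t + z) * (K t z powr m - 1) + (t + z)\<^sup>2 * (m * K t z powr (m - 1) * Kt t z)"

lemma K_gt_1: "t > 1 \<Longrightarrow> - 1 < z \<Longrightarrow> z < 1 \<Longrightarrow> K t z > 1"
  using k_pos[of t z] by (simp add: K_def)

lemma J_deriv:
  assumes "t > 1" "- 1 < z" "z < 1"
  shows "((\<lambda>s. J m s z) has_real_derivative dJ m t z) (at t)"
proof -
  have "((\<lambda>s. K s z) has_real_derivative Kt t z) (at t)"
    unfolding K_def Kt_def using assms
    by (auto intro!: derivative_eq_intros k_deriv_t simp: algebra_simps)
  then show ?thesis
    unfolding J_def dJ_def using assms K_gt_1[OF assms]
    by (auto intro!: derivative_eq_intros simp: algebra_simps)
qed

lemma powr_minus_1_mvt: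
  fixes x m :: real
  assumes "x > 1"
  obtains y where "1 < y" "y < x" "x powr m - 1 = (x - 1) * (m * y powr (m - 1))"
proof -
  have "((\<lambda>x. x powr m) has_real_derivative m * u powr (m - 1)) (at u)" if "1 \<le> u" for u
    using that by (auto intro!: derivative_eq_intros)
  from MVT2[OF assms this] show thesis using that by auto
qed

lemma dJ_sign:
  assumes "t > 1" "- 1 < z" "z < 1" "m > 0"
  shows "g < 1 \<Longrightarrow> m \<ge> 1 \<Longrightarrow> dJ m t z < 0"
    and "g > 1 \<Longrightarrow> m \<le> 1 \<Longrightarrow> dJ m t z > 0"
proof -
  define w where "w = t + z"
  have w: "w > 0" using assms by (simp add: w_def)
  have K1: "K t z > 1" using K_gt_1 assms by blast
  obtain y where y: "1 < y" "y < K t z" "K t z powr m - 1 = (K t z - 1) * (m * y powr (m - 1))"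
    using powr_minus_1_mvt[OF K1] by blast
  have Kt_eq: "2 * (K t z - 1) + w * Kt t z = w powr (- al) * ((2 - al) * k t z + w * kt t z)"
  proof -
    have e: "w powr (- al) = w * w powr (- al - 1)"
      using w by (simp add: powr_diff)
    show ?thesis
      unfolding K_def Kt_def w_def[symmetric] e by (simp add: algebra_simps)
  qed
  \<comment> \<open>Inserting the mean value form of \<open>K powr m - 1\<close> splits
    \<open>dJ\<close> into a positive multiple of the expression for \<open>q = 2\<close> and a
    remainder with the sign of \<open>1 - m\<close>, because \<open>1 < y < K\<close>.\<close>
  have dJ_eq: "dJ m t z = w * m * (2 * (K t z - 1) * (y powr (m - 1) - K t z powr (m - 1))
       + K t z powr (m - 1) * (w powr (- al) * ((2 - al) * k t z + w * kt t z)))"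
    unfolding dJ_def y(3) Kt_eq[symmetric] w_def[symmetric] by (simp add: algebra_simps power2_eq_square)
  show "dJ m t z < 0" if "g < 1" "m \<ge> 1"
  proof -
    have "y powr (m - 1) \<le> K t z powr (m - 1)"
      using y that by (intro powr_mono2) auto
    then have 1: "2 * (K t z - 1) * (y powr (m - 1) - K t z powr (m - 1)) \<le> 0"
      using K1 by (intro mult_nonneg_nonpos) auto
    have "(al - 1) * ((2 - al) * k t z + w * kt t z) < 0"
      using key_sign[of t z] assms that by (simp add: w_def)
    moreover have "al - 1 > 0" using that al_eq by simp
    ultimately have "(2 - al) * k t z + w * kt t z < 0"
      by (simp add: mult_less_0_iff)
    then have 2: "K t z powr (m - 1) * (w powr (- al) * ((2 - al) * k t z + w * kt t z)) < 0"
      using w K1 by (intro mult_pos_neg) auto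
    show ?thesis
      unfolding dJ_eq using w assms(4) 1 2 by (intro mult_pos_neg) auto
  qed
  show "dJ m t z > 0" if "g > 1" "m \<le> 1"
  proof -
    have "K t z powr (m - 1) \<le> y powr (m - 1)"
      using y that by (intro powr_mono2') auto
    then have 1: "2 * (K t z - 1) * (y powr (m - 1) - K t z powr (m - 1)) \<ge> 0"
      using K1 by (intro mult_nonneg_nonneg) auto
    have "(al - 1) * ((2 - al) * k t z + w * kt t z) < 0"
      using key_sign[of t z] assms that by (simp add: w_def)
    moreover have "al - 1 < 0" using that al_eq by simp
    ultimately have "(2 - al) * k t z + w * kt t z > 0"
      by (simp add: mult_less_0_iff)
    then have 2: "K t z powr (m - 1) * (w powr (- al) * ((2 - al) * k t z + w * kt t z)) > 0"
      using w K1 by (intro mult_pos_pos) auto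
    show ?thesis
      unfolding dJ_eq using w assms(4) 1 2 by (intro mult_pos_pos) auto
  qed
qed

lemma k_cont2:
  assumes "1 < t0"
  shows "continuous_on ({t0..t1} \<times> {- 1..1}) (\<lambda>x. k (fst x) (snd x))"
  unfolding k_def using assms by (intro continuous_intros; force)

text \<open>By the mean value form, \<open>J\<close> is \<open>k\<close> times a factor bounded away
  from 0, and each term of \<open>dJ\<close> is \<open>k\<close> or \<open>kt\<close> times a
  bounded factor. The parabola bounds therefore carry over.\<close>

lemma J_bounds:
  assumes "1 < t0" "m > 0"
  obtains c C where "c > 0" "C > 0"
    "\<And>t z. t \<in> {t0..t1} \<Longrightarrow> - 1 < z \<Longrightarrow> z < 1 \<Longrightarrow> c * (1 - z\<^sup>2) \<le> J m t z"
    "\<And>t z. t \<in> {t0..t1} \<Longrightarrow> - 1 < z \<Longrightarrow> z < 1 \<Longrightarrow> \<bar>dJ m t z\<bar> \<le> C * (1 - z\<^sup>2)"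
proof -
  let ?B = "{t0..t1} \<times> {- 1..1::real}"
  have B: "compact ?B" by (intro compact_Times compact_Icc)
  have cK: "continuous_on ?B (\<lambda>x. K (fst x) (snd x))"
    unfolding K_def using assms by (intro continuous_intros k_cont2; force)
  obtain M where M: "M > 0" "\<And>x. x \<in> ?B \<Longrightarrow> \<bar>K (fst x) (snd x)\<bar> \<le> M"
    using compact_abs_bound[OF B cK] by blast
  \<comment> \<open>The intermediate point lies between 1 and \<open>K <= M\<close>, so bounds over
    \<open>{1..M}\<close> serve for either sign of \<open>m - 1\<close>.\<close>
  have cp: "continuous_on {1..M} (\<lambda>y. m * y powr (m - 1))"
    by (intro continuous_intros) auto
  obtain d where d: "d > 0" "\<And>y. y \<in> {1..M} \<Longrightarrow> d \<le> m * y powr (m - 1)"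
    using compact_pos_lower[OF compact_Icc cp] assms(2) by auto
  obtain D where D: "D > 0" "\<And>y. y \<in> {1..M} \<Longrightarrow> \<bar>m * y powr (m - 1)\<bar> \<le> D"
    using compact_abs_bound[OF compact_Icc cp] by blast
  have cw: "continuous_on ?B (\<lambda>x. (fst x + snd x) powr (2 - al))"
    using assms by (intro continuous_intros; force)
  have "(fst x + snd x) powr (2 - al) > 0" if "x \<in> ?B" for x
  proof -
    have "fst x + snd x > 0" using that assms(1) by auto
    then show ?thesis by simp
  qed
  then obtain u where u: "u > 0" "\<And>x. x \<in> ?B \<Longrightarrow> u \<le> (fst x + snd x) powr (2 - al)"
    using compact_pos_lower[OF B cw] by blast
  have cv: "continuous_on ?B (\<lambda>x. (2 + al) * (fst x + snd x) powr (1 - al) + (fst x + snd x) powr (2 - al))"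
    using assms by (intro continuous_intros; force)
  obtain v where v: "v > 0" "\<And>x. x \<in> ?B \<Longrightarrow>
      \<bar>(2 + al) * (fst x + snd x) powr (1 - al) + (fst x + snd x) powr (2 - al)\<bar> \<le> v"
    using compact_abs_bound[OF B cv] by blast
  obtain c0 where c0: "c0 > 0" "\<And>t z. t \<in> {t0..t1} \<Longrightarrow> - 1 \<le> z \<Longrightarrow> z \<le> 1 \<Longrightarrow> c0 * (1 - z\<^sup>2) \<le> k t z"
    using k_lower[OF assms(1)] by blast
  obtain C0 where C0: "C0 > 0"
    "\<And>t z. t \<in> {t0..t1} \<Longrightarrow> - 1 \<le> z \<Longrightarrow> z \<le> 1 \<Longrightarrow> \<bar>k t z\<bar> \<le> C0 * (1 - z\<^sup>2)"
    "\<And>t z. t \<in> {t0..t1} \<Longrightarrow> - 1 \<le> z \<Longrightarrow> z \<le> 1 \<Longrightarrow> \<bar>kt t z\<bar> \<le> C0 * (1 - z\<^sup>2)"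
    using k_kt_upper[OF assms(1)] by blast
  show ?thesis
  proof (rule that[of "u * d * c0" "v * D * C0"])
    show "u * d * c0 > 0" "v * D * C0 > 0" using u v d D c0 C0 by simp_all
    fix t z :: real assume t: "t \<in> {t0..t1}" and z: "- 1 < z" "z < 1"
    define w where "w = t + z"
    have w: "w > 0" using t z assms by (simp add: w_def)
    have tz: "(t, z) \<in> ?B" using t z by simp
    have K1: "K t z > 1" using K_gt_1 t z assms by simp
    have KM: "K t z \<le> M" using M(2)[OF tz] by simp
    obtain y where y: "1 < y" "y < K t z" "K t z powr m - 1 = (K t z - 1) * (m * y powr (m - 1))"
      using powr_minus_1_mvt[OF K1] by blast
    have p2: "w\<^sup>2 * w powr (- al) = w powr (2 - al)"
      using w powr_add[of w 2 "- al"] by simp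
    have p1: "w * w powr (- al) = w powr (1 - al)" "w\<^sup>2 * w powr (- al - 1) = w powr (1 - al)"
      using w powr_add[of w 1 "- al"] powr_add[of w 2 "- al - 1"] by (simp_all add: algebra_simps)
    have zz: "1 - z\<^sup>2 > 0" using z by (simp add: abs_square_less_1 abs_less_iff)
    have "J m t z = w powr (2 - al) * (m * y powr (m - 1)) * k t z"
      unfolding J_def y(3) w_def[symmetric] p2[symmetric] by (simp add: K_def w_def)
    moreover have "u * d * (c0 * (1 - z\<^sup>2)) \<le> w powr (2 - al) * (m * y powr (m - 1)) * k t z"
      using u(2)[OF tz] u(1) d(1) d(2)[of y] y KM c0 t z zz
      by (intro mult_mono) (auto simp: w_def)
    ultimately show "u * d * c0 * (1 - z\<^sup>2) \<le> J m t z" by (simp add: mult.assoc)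
    have Km: "K t z - 1 = w powr (- al) * k t z" by (simp add: K_def w_def)
    define X where "X = 2 * w powr (1 - al) * (m * y powr (m - 1)) * k t z"
    define Y where "Y = w powr (2 - al) * kt t z - al * w powr (1 - al) * k t z"
    have "dJ m t z = 2 * (w * w powr (- al)) * (m * y powr (m - 1)) * k t z
        + (m * K t z powr (m - 1)) *
          ((w\<^sup>2 * w powr (- al)) * kt t z - al * (w\<^sup>2 * w powr (- al - 1)) * k t z)"
      unfolding dJ_def y(3) Kt_def w_def[symmetric] Km by (simp add: algebra_simps)
    then have "dJ m t z = X + (m * K t z powr (m - 1)) * Y"
      unfolding p1 p2 X_def Y_def .
    then have "\<bar>dJ m t z\<bar> \<le> \<bar>X\<bar> + \<bar>m * K t z powr (m - 1)\<bar> * \<bar>Y\<bar>"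
      using abs_triangle_ineq[of X "(m * K t z powr (m - 1)) * Y"] by (simp add: abs_mult)
    also have "\<dots> \<le> 2 * w powr (1 - al) * D * (C0 * (1 - z\<^sup>2))
        + D * (w powr (2 - al) * (C0 * (1 - z\<^sup>2)) + al * w powr (1 - al) * (C0 * (1 - z\<^sup>2)))"
    proof (rule add_mono)
      have "\<bar>X\<bar> = 2 * w powr (1 - al) * \<bar>m * y powr (m - 1)\<bar> * \<bar>k t z\<bar>"
        unfolding X_def abs_mult[of _ "k t z"] abs_mult[of "2 * w powr (1 - al)"] by simp
      also have "\<dots> \<le> 2 * w powr (1 - al) * D * (C0 * (1 - z\<^sup>2))"
        using D(2)[of y] y(1,2) KM C0(2)[OF t] z D(1)
        by (intro mult_mono mult_nonneg_nonneg) auto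
      finally show "\<bar>X\<bar> \<le> 2 * w powr (1 - al) * D * (C0 * (1 - z\<^sup>2))" .
      have "\<bar>Y\<bar> \<le> \<bar>w powr (2 - al) * kt t z\<bar> + \<bar>al * w powr (1 - al) * k t z\<bar>"
        unfolding Y_def by (rule abs_triangle_ineq4)
      also have "\<dots> = w powr (2 - al) * \<bar>kt t z\<bar> + al * w powr (1 - al) * \<bar>k t z\<bar>"
        using al_bounds by (simp add: abs_mult)
      also have "\<dots> \<le> w powr (2 - al) * (C0 * (1 - z\<^sup>2)) + al * w powr (1 - al) * (C0 * (1 - z\<^sup>2))"
        using C0(2,3)[OF t] z al_bounds by (intro add_mono mult_left_mono) auto
      finally have "\<bar>Y\<bar> \<le> w powr (2 - al) * (C0 * (1 - z\<^sup>2)) + al * w powr (1 - al) * (C0 * (1 - z\<^sup>2))" .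
      moreover have "\<bar>m * K t z powr (m - 1)\<bar> \<le> D"
        using D(2)[of "K t z"] K1 KM by simp
      ultimately show "\<bar>m * K t z powr (m - 1)\<bar> * \<bar>Y\<bar>
         \<le> D * (w powr (2 - al) * (C0 * (1 - z\<^sup>2)) + al * w powr (1 - al) * (C0 * (1 - z\<^sup>2)))"
        using D(1) by (intro mult_mono) simp_all
    qed
    also have "\<dots> = ((2 + al) * w powr (1 - al) + w powr (2 - al)) * (D * C0 * (1 - z\<^sup>2))"
      by (simp add: algebra_simps)
    also have "\<dots> \<le> v * (D * C0 * (1 - z\<^sup>2))"
      using v(2)[OF tz] D(1) C0(1) zz by (intro mult_right_mono) (auto simp: w_def)
    finally show "\<bar>dJ m t z\<bar> \<le> v * D * C0 * (1 - z\<^sup>2)" by (simp add: mult.assoc)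
  qed
qed

lemma J_cont:
  assumes "t > 1"
  shows "continuous_on {- 1<..<1} (J m t)"
proof -
  have "continuous_on {- 1<..<1} (k t)"
    unfolding k_def[abs_def] using assms by (intro continuous_intros) auto
  moreover have "1 + (t + z) powr (- al) * k t z \<noteq> 0" if "- 1 < z" "z < 1" for z
    using K_gt_1[OF assms that] unfolding K_def by linarith
  ultimately show ?thesis
    unfolding J_def[abs_def] K_def[abs_def] using assms by (intro continuous_intros) auto
qed

end

section \<open>Differentiation under the integral sign\<close>

text \<open>A nonnegative integrable function with integral 0 vanishes almost everywhere; with
  \<open>f\<close> positive, the open interval would be negligible.\<close>

lemma integral_pos_open_interval:
  fixes f :: "real \<Rightarrow> real"
  assumes int: "f integrable_on {a<..<b}" and pos: "\<And>x. x \<in> {a<..<b} \<Longrightarrow> f x > 0" and "a < b"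
  shows "integral {a<..<b} f > 0"
proof (rule ccontr)
  let ?S = "{a<..<b}"
  assume "\<not> integral ?S f > 0"
  moreover have "integral ?S f \<ge> 0"
    by (intro integral_nonneg int) (use pos in force)
  ultimately have 0: "integral ?S f = 0" by simp
  have "f absolutely_integrable_on ?S"
    by (intro nonnegative_absolutely_integrable_1 int) (use pos in force)
  then have L: "integrable (lebesgue_on ?S) f"
    by (simp add: integrable_restrict_space set_integrable_def)
  have "integral\<^sup>L (lebesgue_on ?S) f = 0"
    using lebesgue_integral_eq_integral[OF L] 0 by simp
  moreover have "AE x in lebesgue_on ?S. 0 \<le> f x"
    by (rule AE_I2) (use pos in \<open>force simp: space_restrict_space\<close>)
  ultimately have "AE x in lebesgue_on ?S. f x = 0"
    using integral_nonneg_eq_0_iff_AE[OF L] by simp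
  then have "AE x in lebesgue. x \<notin> ?S"
    by (subst (asm) AE_restrict_space_iff) (use pos in force)+
  then have "?S \<in> null_sets lebesgue"
    using AE_iff_null_sets[of ?S lebesgue] by simp
  then have "negligible ?S" by (simp add: negligible_iff_null_sets)
  then show False using open_not_negligible[of ?S] \<open>a < b\<close> by auto
qed

text \<open>The mean value theorem bounds all difference quotients by \<open>H\<close>, so dominated
  convergence applies along every sequence of increments tending to 0.\<close>

lemma DERIV_integral_dominated:
  fixes f f' :: "real \<Rightarrow> real \<Rightarrow> real" and S :: "real set"
  assumes t: "t0 < t" "t < t1"
    and f: "\<And>s. s \<in> {t0..t1} \<Longrightarrow> f s integrable_on S"
    and d: "\<And>s z. s \<in> {t0..t1} \<Longrightarrow> z \<in> S \<Longrightarrow> ((\<lambda>s. f s z) has_real_derivative f' s z) (at s)"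
    and H: "\<And>s z. s \<in> {t0..t1} \<Longrightarrow> z \<in> S \<Longrightarrow> \<bar>f' s z\<bar> \<le> H z" "H integrable_on S"
  shows "f' t integrable_on S"
    and "((\<lambda>s. integral S (f s)) has_real_derivative integral S (f' t)) (at t)"
proof -
  have seq: "f' t integrable_on S \<and>
      (\<lambda>n. (integral S (f (t + X n)) - integral S (f t)) / X n) \<longlonglongrightarrow> integral S (f' t)"
    if X: "\<And>n. X n \<noteq> 0" "X \<longlonglongrightarrow> 0" and XI: "\<And>n. t + X n \<in> {t0..t1}" for X :: "nat \<Rightarrow> real"
  proof -
    define F where "F = (\<lambda>n z. (f (t + X n) z - f t z) / X n)"
    have tI: "t \<in> {t0..t1}" using t by simp
    have Fint: "F n integrable_on S" for n
      unfolding F_def using f[OF XI] f[OF tI]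
      by (intro integrable_on_divide integrable_diff)
    have Fle: "norm (F n z) \<le> H z" if z: "z \<in> S" for n z
    proof -
      have "\<exists>\<xi>\<in>{t0..t1}. f (t + X n) z - f t z = X n * f' \<xi> z"
      proof (cases "X n > 0")
        case True
        obtain \<xi> where "t < \<xi>" "\<xi> < t + X n" "f (t + X n) z - f t z = (t + X n - t) * f' \<xi> z"
          using MVT2[of t "t + X n" "\<lambda>s. f s z" "\<lambda>s. f' s z"] True d[OF _ z] t XI[of n] by force
        then show ?thesis using t XI[of n] by (intro bexI[of _ \<xi>]) auto
      next
        case False
        then have neg: "X n < 0" using X(1)[of n] by simp
        obtain \<xi> where "t + X n < \<xi>" "\<xi> < t" "f t z - f (t + X n) z = (t - (t + X n)) * f' \<xi> z"
          using MVT2[of "t + X n" t "\<lambda>s. f s z" "\<lambda>s. f' s z"] neg d[OF _ z] t XI[of n] by force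
        then show ?thesis using t XI[of n] by (intro bexI[of _ \<xi>]) (auto simp: algebra_simps)
      qed
      then obtain \<xi> where "\<xi> \<in> {t0..t1}" "f (t + X n) z - f t z = X n * f' \<xi> z" by blast
      then show ?thesis using H(1)[of \<xi> z] z X(1)[of n] by (simp add: F_def)
    qed
    have lim: "(\<lambda>n. F n z) \<longlonglongrightarrow> f' t z" if z: "z \<in> S" for z
    proof -
      have "(\<lambda>h. (f (t + h) z - f t z) / h) \<midarrow>0\<rightarrow> f' t z"
        using d[OF tI z] by (simp add: DERIV_def)
      then show ?thesis
        unfolding F_def LIMSEQ_SEQ_conv[symmetric] using X by blast
    qed
    have "f' t integrable_on S" "(\<lambda>n. integral S (F n)) \<longlonglongrightarrow> integral S (f' t)"
      using dominated_convergence[OF Fint H(2) Fle lim] by auto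
    moreover have "integral S (F n) = (integral S (f (t + X n)) - integral S (f t)) / X n" for n
      unfolding F_def using f[OF XI] f[OF tI] by (simp add: integral_diff)
    ultimately show ?thesis by simp
  qed
  define \<delta> where "\<delta> = min (t - t0) (t1 - t)"
  have \<delta>: "\<delta> > 0" using t by (simp add: \<delta>_def)
  \<comment> \<open>One concrete sequence of increments is enough for the integrability of
    \<open>f' t\<close>.\<close>
  have "(\<lambda>n. \<delta> * inverse (real (Suc n))) \<longlonglongrightarrow> \<delta> * 0"
    by (intro tendsto_intros LIMSEQ_inverse_real_of_nat)
  moreover have "t + \<delta> * inverse (real (Suc n)) \<in> {t0..t1}" for n
  proof -
    have "\<delta> * inverse (real (Suc n)) \<le> \<delta> * 1"
      using \<delta> by (intro mult_left_mono) (auto simp: field_simps)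
    moreover have "\<delta> * inverse (real (Suc n)) > 0" using \<delta> by simp
    moreover have "\<delta> \<le> t - t0" "\<delta> \<le> t1 - t" by (simp_all add: \<delta>_def)
    ultimately show ?thesis unfolding atLeastAtMost_iff by linarith
  qed
  ultimately show "f' t integrable_on S"
    using seq[of "\<lambda>n. \<delta> * inverse (real (Suc n))"] \<delta> by simp
  have "(\<lambda>h. (integral S (f (t + h)) - integral S (f t)) / h) \<midarrow>0\<rightarrow> integral S (f' t)"
    unfolding LIMSEQ_SEQ_conv[symmetric]
  proof (intro allI impI)
    fix X :: "nat \<Rightarrow> real" assume X: "(\<forall>n. X n \<noteq> 0) \<and> X \<longlonglongrightarrow> 0"
    have "eventually (\<lambda>n. \<bar>X n\<bar> < \<delta>) sequentially"
      using X \<delta> tendstoD[of X 0 sequentially \<delta>] by (simp add: dist_real_def)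
    \<comment> \<open>An arbitrary null sequence may leave \<open>{t0..t1}\<close> at first; a tail
      stays inside and has the same limit.\<close>
    then obtain N where N: "\<And>n. n \<ge> N \<Longrightarrow> \<bar>X n\<bar> < \<delta>"
      by (auto simp: eventually_sequentially)
    have "t + X (n + N) \<in> {t0..t1}" for n
      using N[of "n + N"] by (auto simp: \<delta>_def min_def split: if_splits)
    then have "(\<lambda>n. (integral S (f (t + X (n + N))) - integral S (f t)) / X (n + N)) \<longlonglongrightarrow> integral S (f' t)"
      using seq[of "\<lambda>n. X (n + N)"] X by (simp add: LIMSEQ_ignore_initial_segment)
    then show "(\<lambda>n. (integral S (f (t + X n)) - integral S (f t)) / X n) \<longlonglongrightarrow> integral S (f' t)"
      by (rule LIMSEQ_offset)
  qed
  then show "((\<lambda>s. integral S (f s)) has_real_derivative integral S (f' t)) (at t)"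
    by (simp add: DERIV_def)
qed

text \<open>The primitive \<open>arcsin\<close> is continuous up to the ends but differentiable only
  inside, hence the interior form of the fundamental theorem.\<close>

lemma rsqrt_parabola_integrable: "(\<lambda>z::real. 1 / sqrt (1 - z\<^sup>2)) integrable_on {-1<..<1}"
proof -
  have "((\<lambda>z::real. inverse (sqrt (1 - z\<^sup>2))) has_integral (arcsin 1 - arcsin (- 1))) {-1..1}"
    by (rule fundamental_theorem_of_calculus_interior)
       (auto intro!: continuous_on_arcsin' simp: DERIV_arcsin simp flip: has_real_derivative_iff_has_vector_derivative)
  then show ?thesis
    unfolding integrable_on_open_interval_real by (auto simp: integrable_on_def inverse_eq_divide)
qed

section \<open>Integrals of \<open>1 / sqrt J\<close> for \<open>J\<close> bounded below by a
  parabola\<close>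

context
  fixes J J' :: "real \<Rightarrow> real \<Rightarrow> real" and t0 t t1 c C :: real
  assumes t: "t0 < t" "t < t1" and c: "c > 0" and C: "C > 0"
    and lower: "\<And>s z. s \<in> {t0..t1} \<Longrightarrow> - 1 < z \<Longrightarrow> z < 1 \<Longrightarrow> c * (1 - z\<^sup>2) \<le> J s z"
    and upper: "\<And>s z. s \<in> {t0..t1} \<Longrightarrow> - 1 < z \<Longrightarrow> z < 1 \<Longrightarrow> \<bar>J' s z\<bar> \<le> C * (1 - z\<^sup>2)"
    and deriv: "\<And>s z. s \<in> {t0..t1} \<Longrightarrow> - 1 < z \<Longrightarrow> z < 1 \<Longrightarrow> ((\<lambda>s. J s z) has_real_derivative J' s z) (at s)"
    and cont: "\<And>s. s \<in> {t0..t1} \<Longrightarrow> continuous_on {-1<..<1} (J s)"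
begin

lemma J_gt_0:
  assumes "s \<in> {t0..t1}" "- 1 < z" "z < 1"
  shows "J s z > 0"
proof -
  have "0 < c * (1 - z\<^sup>2)" using c assms by (simp add: abs_square_less_1 abs_less_iff)
  then show ?thesis using lower[OF assms] by linarith
qed

lemma rsqrt_J_integrable:
  assumes s: "s \<in> {t0..t1}"
  shows "(\<lambda>z. 1 / sqrt (J s z)) integrable_on {-1<..<1}"
proof (rule measurable_bounded_by_integrable_imp_integrable)
  show "(\<lambda>z. 1 / sqrt (J s z)) \<in> borel_measurable (lebesgue_on {-1<..<1})"
    using J_gt_0[OF s]
    by (intro continuous_imp_measurable_on_sets_lebesgue continuous_intros cont s) force+
  show "(\<lambda>z. 1 / sqrt c * (1 / sqrt (1 - z\<^sup>2))) integrable_on {-1<..<1}"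
    by (intro integrable_on_mult_right rsqrt_parabola_integrable)
  fix z :: real assume "z \<in> {-1<..<1}"
  then have z: "- 1 < z" "z < 1" by auto
  have "0 < c * (1 - z\<^sup>2)" using c z by (simp add: abs_square_less_1 abs_less_iff)
  then have "1 / sqrt (J s z) \<le> 1 / sqrt (c * (1 - z\<^sup>2))"
    using lower[OF s z] by (intro divide_left_mono mult_pos_pos) auto
  then show "norm (1 / sqrt (J s z)) \<le> 1 / sqrt c * (1 / sqrt (1 - z\<^sup>2))"
    using J_gt_0[OF s z] by (simp add: real_sqrt_mult)
qed auto

lemma rsqrt_integral_deriv:
  shows "(\<lambda>z. - J' t z / (2 * J t z * sqrt (J t z))) integrable_on {-1<..<1}"
    and "((\<lambda>s. integral {-1<..<1} (\<lambda>z. 1 / sqrt (J s z))) has_real_derivative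
           integral {-1<..<1} (\<lambda>z. - J' t z / (2 * J t z * sqrt (J t z)))) (at t)"
proof -
  let ?f = "\<lambda>s z. 1 / sqrt (J s z)" and ?f' = "\<lambda>s z. - J' s z / (2 * J s z * sqrt (J s z))"
  \<comment> \<open>With \<open>e = 1 - z^2\<close> the derivative of \<open>J powr (-1/2)\<close>
    is bounded by \<open>C * e / (2 * (c * e) powr (3/2))\<close>, which is again a multiple of
    \<open>1 / sqrt e\<close>.\<close>
  let ?H = "\<lambda>z::real. C / (2 * c * sqrt c) * (1 / sqrt (1 - z\<^sup>2))"
  have H: "?H integrable_on {-1<..<1}"
    by (intro integrable_on_mult_right rsqrt_parabola_integrable)
  have d: "((\<lambda>s. ?f s z) has_real_derivative ?f' s z) (at s)" if "s \<in> {t0..t1}" "z \<in> {-1<..<1}" for s z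
  proof -
    have z: "- 1 < z" "z < 1" using that by auto
    have J: "J s z > 0" using J_gt_0[OF that(1) z] .
    have "((\<lambda>s. sqrt (J s z)) has_real_derivative inverse (sqrt (J s z)) / 2 * J' s z) (at s)"
      by (rule DERIV_chain2[OF DERIV_real_sqrt[OF J] deriv[OF that(1) z]])
    then have "((\<lambda>s. 1 / sqrt (J s z)) has_real_derivative
        (0 * sqrt (J s z) - 1 * (inverse (sqrt (J s z)) / 2 * J' s z)) / (sqrt (J s z) * sqrt (J s z))) (at s)"
      using J by (intro DERIV_divide) auto
    then show ?thesis
    proof (rule DERIV_cong)
      have "(sqrt (J s z) * sqrt (J s z)) = J s z" using J by simp
      then show "(0 * sqrt (J s z) - 1 * (inverse (sqrt (J s z)) / 2 * J' s z)) / (sqrt (J s z) * sqrt (J s z)) = ?f' s z"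
        by (simp add: field_simps)
    qed
  qed
  have b: "\<bar>?f' s z\<bar> \<le> ?H z" if s: "s \<in> {t0..t1}" and "z \<in> {-1<..<1}" for s z
  proof -
    have z: "- 1 < z" "z < 1" using that by auto
    define e where "e = 1 - z\<^sup>2"
    have e: "e > 0" using z by (simp add: e_def abs_square_less_1 abs_less_iff)
    have J: "J s z > 0" using J_gt_0[OF s z] .
    have 1: "c * e \<le> J s z" using lower[OF s z] by (simp add: e_def)
    have "\<bar>?f' s z\<bar> = \<bar>J' s z\<bar> / (2 * J s z * sqrt (J s z))"
      using J by (simp add: abs_mult)
    also have "\<dots> \<le> (C * e) / (2 * (c * e) * sqrt (c * e))"
      using upper[OF s z] 1 e c J C
      by (intro frac_le mult_mono) (auto simp: e_def[symmetric])
    also have "\<dots> = C / (2 * c * sqrt c) * (1 / sqrt e)"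
      using e c by (simp add: real_sqrt_mult field_simps)
    finally show ?thesis by (simp add: e_def)
  qed
  show "(\<lambda>z. - J' t z / (2 * J t z * sqrt (J t z))) integrable_on {-1<..<1}"
    by (rule DERIV_integral_dominated(1)[where f = ?f and f' = ?f', OF t _ d b H]) (rule rsqrt_J_integrable)
  show "((\<lambda>s. integral {-1<..<1} (\<lambda>z. 1 / sqrt (J s z))) has_real_derivative
           integral {-1<..<1} (\<lambda>z. - J' t z / (2 * J t z * sqrt (J t z)))) (at t)"
    by (rule DERIV_integral_dominated(2)[where f = ?f and f' = ?f', OF t _ d b H]) (rule rsqrt_J_integrable)
qed

lemma rsqrt_integral_deriv_sign:
  obtains D where "((\<lambda>s. integral {-1<..<1} (\<lambda>z. 1 / sqrt (J s z))) has_real_derivative D) (at t)"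
    "(\<And>z. - 1 < z \<Longrightarrow> z < 1 \<Longrightarrow> J' t z < 0) \<Longrightarrow> D > 0"
    "(\<And>z. - 1 < z \<Longrightarrow> z < 1 \<Longrightarrow> J' t z > 0) \<Longrightarrow> D < 0"
proof (rule that[OF rsqrt_integral_deriv(2)])
  let ?F = "\<lambda>z. - J' t z / (2 * J t z * sqrt (J t z))"
  have tI: "t \<in> {t0..t1}" using t by simp
  show "0 < integral {-1<..<1} ?F" if "\<And>z. - 1 < z \<Longrightarrow> z < 1 \<Longrightarrow> J' t z < 0"
    using that J_gt_0[OF tI]
    by (intro integral_pos_open_interval rsqrt_integral_deriv) (auto intro!: divide_neg_pos)
  show "integral {-1<..<1} ?F < 0" if neg: "\<And>z. - 1 < z \<Longrightarrow> z < 1 \<Longrightarrow> J' t z > 0"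
  proof -
    have "0 < integral {-1<..<1} (\<lambda>z. - ?F z)"
      using neg J_gt_0[OF tI]
      by (intro integral_pos_open_interval integrable_neg rsqrt_integral_deriv) auto
    then show ?thesis by (simp add: integral_neg)
  qed
qed

end

section \<open>The change of variables\<close>

text \<open>\<open>p_eq\<close> is \<open>p / q = - g / al\<close> without division. Together with
  \<open>2 * al + g = 3\<close> it gives \<open>3 / (2 - p / q) = al\<close>, the exponent in the
  definitions.\<close>

locale period_function = period_exponents +
  fixes p q :: real
  assumes q_pos: "q > 0" and p_eq: "al * p = - g * q"
begin

lemma p_zero_iff: "p = 0 \<longleftrightarrow> g = 0"
  using p_eq q_pos al_bounds by auto

text \<open>An affine interpolation between two powers, with a ratio of \<open>pow_prim\<close>
  increments as its parameter. The power and the logarithmic definitions are both brought to this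
  form.\<close>

lemma K_eq_interpolation:
  assumes "t > 1" "- 1 < z"
  defines "w \<equiv> t + z"
  shows "K t z = ((t + 1) / w) powr al - (((t + 1) / w) powr al - ((t - 1) / w) powr al) *
     ((pow_prim g (t + 1) - pow_prim g w) / (pow_prim g (t + 1) - pow_prim g (t - 1)))"
proof -
  have w: "w > 0" using assms by simp
  have "K t z = w powr (- al) * (P t + Q t * pow_prim g w)"
    using w by (simp add: K_def k_def w_def[symmetric] right_diff_distrib flip: powr_add)
  also have "P t + Q t * pow_prim g w = (t + 1) powr al - ((t + 1) powr al - (t - 1) powr al) *
     ((pow_prim g (t + 1) - pow_prim g w) / (pow_prim g (t + 1) - pow_prim g (t - 1)))"
    by (simp add: P_def Q_def diff_divide_distrib algebra_simps)
  also have "w powr (- al) * \<dots> = ((t + 1) / w) powr al - (((t + 1) / w) powr al - ((t - 1) / w) powr al) *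
     ((pow_prim g (t + 1) - pow_prim g w) / (pow_prim g (t + 1) - pow_prim g (t - 1)))"
  proof -
    have e: "((t + 1) / w) powr al = w powr (- al) * (t + 1) powr al"
      "((t - 1) / w) powr al = w powr (- al) * (t - 1) powr al"
      using w assms(1) by (simp_all add: powr_divide powr_minus_divide)
    show ?thesis unfolding e by (simp only: right_diff_distrib left_diff_distrib mult.assoc)
  qed
  finally show ?thesis .
qed

lemma rho_eq: "al * (p / q) = - g" "3 / (2 - p / q) = al"
proof -
  show 1: "al * (p / q) = - g" using p_eq q_pos by (simp add: field_simps)
  have "al * (2 - p / q) = 2 * al - al * (p / q)" by (simp only: right_diff_distrib mult.commute)
  also have "\<dots> = 3" unfolding 1 using al_eq by simp
  finally have "al * (2 - p / q) = 3" .
  then show "3 / (2 - p / q) = al" by (metis mult_zero_right nonzero_eq_divide_eq zero_neq_numeral)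
qed

lemma powr_g_distinct:
  assumes "t > 1" "- 1 < z" "g \<noteq> 0"
  shows "((t + 1) / (t + z)) powr (- g) \<noteq> ((t - 1) / (t + z)) powr (- g)"
proof -
  have "((t + 1) / (t + z)) powr (- g) < ((t - 1) / (t + z)) powr (- g)"
    using assms g_bounds by (intro powr_less_mono2_neg divide_strict_right_mono) auto
  then show ?thesis by simp
qed

lemma Krho_eq:
  assumes t: "t > 1" "- 1 < z" and p: "p \<noteq> 0"
  shows "Krho (p / q) t z = K t z"
proof -
  define w where "w = t + z"
  define A B X Y where "A = ((t + 1) / w) powr al" and "B = ((t - 1) / w) powr al"
    and "X = ((t + 1) / w) powr (- g)" and "Y = ((t - 1) / w) powr (- g)"
  have w: "w > 0" using t by (simp add: w_def)
  have g: "g \<noteq> 0" using p p_zero_iff by simp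
  have AB: "A > 0" "B > 0" "X > 0" "Y > 0" using t w by (auto simp: A_def B_def X_def Y_def)
  have XY: "X \<noteq> Y" unfolding X_def Y_def w_def using powr_g_distinct t g by blast
  have AX: "A powr (p / q) = X" "B powr (p / q) = Y"
    using rho_eq by (simp_all add: A_def B_def X_def Y_def powr_powr)
  have "Krho (p / q) t z = (A powr (1 - p / q) - B powr (1 - p / q)) / (A powr (- (p / q)) - B powr (- (p / q)))
      + (A - B) / (A powr (p / q) - B powr (p / q))"
    unfolding Krho_def Let_def rho_eq w_def[symmetric] A_def B_def ..
  also have "\<dots> = (A / X - B / Y) / (1 / X - 1 / Y) + (A - B) / (X - Y)"
    using AB by (simp add: AX powr_diff powr_minus_divide)
  \<comment> \<open>Both sides are \<open>(A * Y - B * X - A + B) / (Y - X)\<close>.\<close>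
  also have "\<dots> = A - (A - B) * ((1 - X) / (Y - X))"
    using AB XY by (simp add: divide_simps) (simp add: algebra_simps)
  also have "(1 - X) / (Y - X) = (pow_prim g (t + 1) - pow_prim g w) / (pow_prim g (t + 1) - pow_prim g (t - 1))"
  proof -
    define a b v where "a = (t + 1) powr (- g)" and "b = (t - 1) powr (- g)" and "v = w powr (- g)"
    have X: "X = a / v" and Y: "Y = b / v"
      using t w by (simp_all add: X_def Y_def a_def b_def v_def powr_divide)
    have v: "v > 0" using w by (simp add: v_def)
    have ab: "a \<noteq> b" using XY X Y by auto
    have "pow_prim g (t + 1) - pow_prim g w = (v - a) / g" "pow_prim g (t + 1) - pow_prim g (t - 1) = (b - a) / g"
      using g by (simp_all add: pow_prim_def a_def b_def v_def diff_divide_distrib)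
    then have "(pow_prim g (t + 1) - pow_prim g w) / (pow_prim g (t + 1) - pow_prim g (t - 1)) = (v - a) / (b - a)"
      using g by simp
    also have "\<dots> = (1 - X) / (Y - X)"
      unfolding X Y using v ab by (simp add: divide_simps)
    finally show ?thesis ..
  qed
  finally show ?thesis
    using K_eq_interpolation[OF t] by (simp add: A_def B_def w_def)
qed

lemma Lfun_eq:
  assumes t: "t > 1" "- 1 < z" and p: "p = 0"
  shows "Lfun t z = K t z"
proof -
  define w where "w = t + z"
  have w: "w > 0" using t by (simp add: w_def)
  have g: "g = 0" "al = 3 / 2" using p p_zero_iff al_eq by auto
  define A B where "A = ((t + 1) / w) powr al" and "B = ((t - 1) / w) powr al"
  have ln: "ln A = al * (ln (t + 1) - ln w)" "ln B = al * (ln (t - 1) - ln w)"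
    using t w by (simp_all add: A_def B_def ln_powr ln_div)
  have d: "ln (t + 1) - ln (t - 1) \<noteq> 0" using t by simp
  have "ln A - ln B = al * (ln (t + 1) - ln (t - 1))"
    unfolding ln by (simp add: algebra_simps)
  then have lnAB: "ln A - ln B \<noteq> 0" using d al_bounds by simp
  have "Lfun t z = (B * ln A - A * ln B) / (ln A - ln B)"
    by (simp add: Lfun_def Let_def A_def B_def w_def g)
  also have "\<dots> = A - (A - B) * (ln A / (ln A - ln B))"
    using lnAB by (simp add: divide_simps) (simp add: algebra_simps)
  also have "ln A / (ln A - ln B) = (pow_prim g (t + 1) - pow_prim g w) / (pow_prim g (t + 1) - pow_prim g (t - 1))"
    unfolding \<open>ln A - ln B = _\<close> using al_bounds by (simp add: ln pow_prim_def g(1))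
  finally show ?thesis
    using K_eq_interpolation[OF t] by (simp add: A_def B_def w_def)
qed

lemma Jt_eq:
  assumes "t > 1" "- 1 < z"
  shows "Jt p q t z = J (2 / q) t z"
  using Krho_eq[OF assms] Lfun_eq[OF assms] by (simp add: Jt_def J_def add.commute)

section \<open>The substitution in the period integral\<close>

definition base :: "real \<Rightarrow> real \<Rightarrow> real" where
  "base r x = (if p \<noteq> 0 then (r powr p - r powr q) / (r powr p - 1) + (r powr q - 1) / (r powr p - 1) * x powr p
     else 1 + (r powr q - 1) / ln r * ln x)"

lemma Theta_base:
  "Theta p q r = integral {1..r} (\<lambda>x. 1 / sqrt (base r x powr (2 / q) - x\<^sup>2))"
  by (simp add: Theta_def base_def)

text \<open>\<open>q / al\<close> equals \<open>(2 * q - p) / 3\<close>, the exponent of the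
  substitution between \<open>r\<close> and \<open>t\<close>.\<close>

definition tpar :: "real \<Rightarrow> real" where
  "tpar r = (r powr (q / al) + 1) / (r powr (q / al) - 1)"

text \<open>Sends \<open>z = -1\<close> to 1 and, for \<open>t = tpar r\<close>,
  \<open>z = 1\<close> to \<open>r\<close>.\<close>

definition xpar :: "real \<Rightarrow> real \<Rightarrow> real" where
  "xpar t z = ((t + z) / (t - 1)) powr (al / q)"

lemma tpar_gt_1:
  assumes "r > 1"
  shows "tpar r > 1"
proof -
  have "r powr (q / al) > 1" using assms q_pos al_bounds by simp
  then show ?thesis by (simp add: tpar_def)
qed

lemma tpar_ratio:
  assumes "r > 1"
  shows "((tpar r + 1) / (tpar r - 1)) powr al = r powr q"
    and "((tpar r + 1) / (tpar r - 1)) powr (al / q) = r"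
proof -
  define y where "y = r powr (q / al)"
  have y: "y > 1" using assms q_pos al_bounds by (simp add: y_def)
  have "tpar r + 1 = 2 * y / (y - 1)" "tpar r - 1 = 2 / (y - 1)"
    using y by (simp_all add: tpar_def y_def[symmetric] field_simps)
  then have "(tpar r + 1) / (tpar r - 1) = y" using y by simp
  then show "((tpar r + 1) / (tpar r - 1)) powr al = r powr q"
    "((tpar r + 1) / (tpar r - 1)) powr (al / q) = r"
    using assms al_bounds q_pos by (simp_all add: y_def powr_powr)
qed

text \<open>In terms of \<open>A\<close> and \<open>B\<close> one has
  \<open>r powr q = A / B\<close> and \<open>x powr q = 1 / B\<close>. Powers with exponent
  \<open>p / q\<close>, or logarithms if \<open>p = 0\<close>, then turn the coefficients of the
  integrand into those of \<open>K\<close>.\<close>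

lemma base_xpar:
  assumes r: "r > 1" and z: "- 1 < z"
  defines "t \<equiv> tpar r"
  shows "base r (xpar t z) = xpar t z powr q * K t z"
proof -
  have t: "t > 1" using r tpar_gt_1 by (simp add: t_def)
  define w where "w = t + z"
  have w: "w > 0" using t z by (simp add: w_def)
  define A B where "A = ((t + 1) / w) powr al" and "B = ((t - 1) / w) powr al"
  have AB: "A > 0" "B > 0" using t w by (auto simp: A_def B_def)
  have R: "r powr q = A / B"
    using tpar_ratio(1)[OF r] t w by (simp add: t_def[symmetric] A_def B_def powr_divide)
  have xq: "xpar t z powr q = 1 / B"
    using q_pos t w by (simp add: xpar_def powr_powr w_def[symmetric] B_def powr_divide)
  have x: "xpar t z > 0" using t w by (simp add: xpar_def w_def[symmetric])
  show ?thesis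
  proof (cases "p = 0")
    case False
    define X Y where "X = A powr (p / q)" and "Y = B powr (p / q)"
    have XY: "X > 0" "Y > 0" using AB by (auto simp: X_def Y_def)
    have "X \<noteq> Y"
      using powr_g_distinct[OF t z] False p_zero_iff rho_eq
      by (simp add: X_def Y_def A_def B_def powr_powr w_def)
    have pq: "y powr p = (y powr q) powr (p / q)" for y :: real
      using q_pos by (simp add: powr_powr)
    have Rp: "r powr p = X / Y" unfolding pq R using AB by (simp add: X_def Y_def powr_divide)
    have xp: "xpar t z powr p = 1 / Y" unfolding pq xq using AB by (simp add: Y_def powr_divide)
    have K: "K t z = (A / X - B / Y) / (1 / X - 1 / Y) + (A - B) / (X - Y)"
      using AB unfolding Krho_eq[OF t z False, symmetric] Krho_def Let_def rho_eq w_def[symmetric]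
        A_def[symmetric] B_def[symmetric]
      by (simp add: X_def Y_def powr_diff powr_minus_divide)
    show ?thesis
      unfolding base_def R Rp xp xq K using False AB XY \<open>X \<noteq> Y\<close>
      by (simp add: divide_simps) (simp add: algebra_simps)
  next
    case True
    have g: "g = 0" "al = 3 / 2" using True p_zero_iff al_eq by auto
    have lr: "q * ln r = ln A - ln B"
      using arg_cong[OF R, of ln] r AB by (simp add: ln_powr ln_div)
    have lx: "q * ln (xpar t z) = - ln B"
      using arg_cong[OF xq, of ln] x AB by (simp add: ln_powr ln_div)
    have lr0: "ln r > 0" using r by simp
    have K: "K t z = (B * ln A - A * ln B) / (ln A - ln B)"
      unfolding Lfun_eq[OF t z True, symmetric] Lfun_def Let_def by (simp add: A_def B_def w_def g)
    have "K t z = (B * (ln A - ln B) - (A - B) * ln B) / (ln A - ln B)"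
      unfolding K by (simp add: algebra_simps)
    also have "\<dots> = (B * (q * ln r) + (A - B) * (q * ln (xpar t z))) / (q * ln r)"
      unfolding lr lx by simp
    also have "\<dots> = B + (A - B) / ln r * ln (xpar t z)"
      using lr0 q_pos by (simp add: field_simps)
    finally have *: "K t z = B + (A - B) / ln r * ln (xpar t z)" .
    have "A / B - 1 = (A - B) / B" using AB by (simp add: diff_divide_distrib)
    then have "K t z = B * (1 + (A / B - 1) / ln r * ln (xpar t z))"
      unfolding * using AB by (simp add: distrib_left)
    moreover have "base r (xpar t z) = 1 + (A / B - 1) / ln r * ln (xpar t z)"
      unfolding base_def R using True by simp
    ultimately show ?thesis unfolding xq using AB by simp
  qed
qed

lemma xpar_deriv:
  assumes "t > 1" "- 1 < z"
  shows "(xpar t has_real_derivative al / q * xpar t z / (t + z)) (at z)"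
proof -
  have "(xpar t has_real_derivative al / q * ((t + z) / (t - 1)) powr (al / q - 1) * (1 / (t - 1))) (at z)"
    unfolding xpar_def[abs_def] using assms q_pos by (auto intro!: derivative_eq_intros)
  then show ?thesis
  proof (rule DERIV_cong)
    have "((t + z) / (t - 1)) powr (al / q - 1) = xpar t z / ((t + z) / (t - 1))"
      using assms by (simp add: xpar_def powr_diff)
    then show "al / q * ((t + z) / (t - 1)) powr (al / q - 1) * (1 / (t - 1)) = al / q * xpar t z / (t + z)"
      using assms by simp
  qed
qed

lemma xpar_image:
  assumes r: "r > 1"
  defines "t \<equiv> tpar r"
  shows "xpar t ` {-1<..<1} = {1<..<r}" and "inj_on (xpar t) {-1<..<1}"
proof -
  have t: "t > 1" using r tpar_gt_1 by (simp add: t_def)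
  have e: "al / q > 0" using al_bounds q_pos by simp
  have less: "xpar t z < xpar t z'" if "- 1 \<le> z" "z < z'" for z z'
    unfolding xpar_def using that t e by (intro powr_less_mono2 divide_strict_right_mono) auto
  have ends: "xpar t (- 1) = 1" "xpar t 1 = r"
    using t tpar_ratio(2)[OF r] by (simp_all add: xpar_def t_def)
  show "inj_on (xpar t) {-1<..<1}"
  proof (rule linorder_inj_onI)
    fix x y :: real assume "x < y" "x \<in> {-1<..<1}" "y \<in> {-1<..<1}"
    then show "xpar t x \<noteq> xpar t y" using less[of x y] by simp
  qed (simp add: linear)
  show "xpar t ` {-1<..<1} = {1<..<r}"
  proof (intro equalityI subsetI)
    fix x assume "x \<in> xpar t ` {-1<..<1}"
    then show "x \<in> {1<..<r}" using less[of "- 1"] less[of _ 1] ends by force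
  next
    fix x assume x: "x \<in> {1<..<r}"
    define z where "z = (t - 1) * x powr (q / al) - t"
    have "xpar t z = x" using x t q_pos al_bounds by (simp add: xpar_def z_def powr_powr)
    moreover have "z > - 1"
    proof -
      have "x powr (q / al) > 1" using x q_pos al_bounds by simp
      then have "(t - 1) * x powr (q / al) > (t - 1) * 1" using t by (intro mult_strict_left_mono) auto
      then show ?thesis by (simp add: z_def)
    qed
    moreover have "z < 1"
      using less[of 1 z] ends x \<open>xpar t z = x\<close> by (cases "z = 1") (force simp: not_less)+
    ultimately show "x \<in> xpar t ` {-1<..<1}" by force
  qed
qed

lemma J_local_bounds:
  assumes "t > 1" "m > 0"
  obtains t0 t1 c C where "t0 < t" "t < t1" "c > 0" "C > 0"
    "\<And>s z. s \<in> {t0..t1} \<Longrightarrow> - 1 < z \<Longrightarrow> z < 1 \<Longrightarrow> c * (1 - z\<^sup>2) \<le> J m s z"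
    "\<And>s z. s \<in> {t0..t1} \<Longrightarrow> - 1 < z \<Longrightarrow> z < 1 \<Longrightarrow> \<bar>dJ m s z\<bar> \<le> C * (1 - z\<^sup>2)"
    "\<And>s z. s \<in> {t0..t1} \<Longrightarrow> - 1 < z \<Longrightarrow> z < 1 \<Longrightarrow> ((\<lambda>s. J m s z) has_real_derivative dJ m s z) (at s)"
    "\<And>s. s \<in> {t0..t1} \<Longrightarrow> continuous_on {-1<..<1} (J m s)"
proof -
  \<comment> \<open>A left end strictly between 1 and \<open>t\<close> keeps the compact interval
    inside the domain \<open>t > 1\<close>.\<close>
  define t0 where "t0 = (1 + t) / 2"
  have t0: "1 < t0" "t0 < t" "t < t + 1" using assms by (auto simp: t0_def)
  obtain c C where cC: "c > 0" "C > 0"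
    "\<And>s z. s \<in> {t0..t + 1} \<Longrightarrow> - 1 < z \<Longrightarrow> z < 1 \<Longrightarrow> c * (1 - z\<^sup>2) \<le> J m s z"
    "\<And>s z. s \<in> {t0..t + 1} \<Longrightarrow> - 1 < z \<Longrightarrow> z < 1 \<Longrightarrow> \<bar>dJ m s z\<bar> \<le> C * (1 - z\<^sup>2)"
    using J_bounds[OF t0(1) assms(2), of "t + 1"] by metis
  show ?thesis
    by (rule that[OF t0(2,3) cC]) (use J_deriv J_cont t0 in auto)
qed

lemma J_integrable:
  assumes "t > 1" "m > 0"
  shows "(\<lambda>z. 1 / sqrt (J m t z)) integrable_on {-1<..<1}"
proof -
  obtain t0 t1 c C where *: "t0 < t" "t < t1" "c > 0" "C > 0"
    "\<And>s z. s \<in> {t0..t1} \<Longrightarrow> - 1 < z \<Longrightarrow> z < 1 \<Longrightarrow> c * (1 - z\<^sup>2) \<le> J m s z"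
    "\<And>s z. s \<in> {t0..t1} \<Longrightarrow> - 1 < z \<Longrightarrow> z < 1 \<Longrightarrow> \<bar>dJ m s z\<bar> \<le> C * (1 - z\<^sup>2)"
    "\<And>s z. s \<in> {t0..t1} \<Longrightarrow> - 1 < z \<Longrightarrow> z < 1 \<Longrightarrow> ((\<lambda>s. J m s z) has_real_derivative dJ m s z) (at s)"
    "\<And>s. s \<in> {t0..t1} \<Longrightarrow> continuous_on {-1<..<1} (J m s)"
    using J_local_bounds[OF assms] by blast
  show ?thesis
    by (rule rsqrt_J_integrable[of t0 t t1 c C "J m" "dJ m", OF *]) (use *(1,2) in auto)
qed

text \<open>At \<open>x = xpar t z\<close> the integrand is
  \<open>1 / (x * sqrt (K powr (2 / q) - 1))\<close>, while
  \<open>dx = al / q * x / (t + z) dz\<close>. The factor \<open>x\<close> cancels, and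
  \<open>t + z\<close> times the root is \<open>sqrt J\<close>.\<close>

lemma Theta_eq:
  assumes r: "r > 1"
  shows "Theta p q r = al / q * integral {-1<..<1} (\<lambda>z. 1 / sqrt (J (2 / q) (tpar r) z))"
proof -
  define t where "t = tpar r"
  have t: "t > 1" using r tpar_gt_1 by (simp add: t_def)
  define f where "f = (\<lambda>x. 1 / sqrt (base r x powr (2 / q) - x\<^sup>2))"
  define I where "I = integral {-1<..<1} (\<lambda>z. 1 / sqrt (J (2 / q) t z))"
  have eq: "\<bar>al / q * xpar t z / (t + z)\<bar> * f (xpar t z) = al / q * (1 / sqrt (J (2 / q) t z))"
    if z: "- 1 < z" "z < 1" for z
  proof -
    have w: "t + z > 0" using t z by simp
    have x: "xpar t z > 0" using t w by (simp add: xpar_def)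
    have K1: "K t z > 1" using K_gt_1[OF t z] .
    have "base r (xpar t z) powr (2 / q) = (xpar t z)\<^sup>2 * K t z powr (2 / q)"
      using base_xpar[OF r z(1)] x K1 q_pos by (simp add: t_def[symmetric] powr_mult powr_powr)
    then have "base r (xpar t z) powr (2 / q) - (xpar t z)\<^sup>2 = (xpar t z)\<^sup>2 * (K t z powr (2 / q) - 1)"
      by (simp add: right_diff_distrib)
    then have f: "f (xpar t z) = 1 / (xpar t z * sqrt (K t z powr (2 / q) - 1))"
      unfolding f_def using x by (simp only: real_sqrt_mult) simp
    have J: "sqrt (J (2 / q) t z) = (t + z) * sqrt (K t z powr (2 / q) - 1)"
      using w by (simp add: J_def real_sqrt_mult)
    have "\<bar>al / q * xpar t z / (t + z)\<bar> = al / q * xpar t z / (t + z)"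
      using x w al_bounds q_pos by simp
    then show ?thesis
      unfolding f J using x by simp
  qed
  \<comment> \<open>Integrability is known on the \<open>z\<close> side. For a nonnegative integrand
    it is absolute, as the change of variables requires.\<close>
  have int: "(\<lambda>z. al / q * (1 / sqrt (J (2 / q) t z))) integrable_on {-1<..<1}"
    using J_integrable[OF t, of "2 / q"] q_pos by (intro integrable_on_mult_right) simp
  have "(\<lambda>z. \<bar>al / q * xpar t z / (t + z)\<bar> * f (xpar t z)) integrable_on {-1<..<1}"
    by (rule integrable_eq[OF int]) (use eq in force)
  then have "(\<lambda>z. \<bar>al / q * xpar t z / (t + z)\<bar> * f (xpar t z)) absolutely_integrable_on {-1<..<1}"
  proof (rule nonnegative_absolutely_integrable_1)
    fix z :: real assume "z \<in> {-1<..<1}"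
    then have z: "- 1 < z" "z < 1" by auto
    have "K t z powr (2 / q) \<ge> 1"
      using K_gt_1[OF t z] q_pos by (intro ge_one_powr_ge_zero) auto
    then have "J (2 / q) t z \<ge> 0" by (simp add: J_def)
    then show "0 \<le> \<bar>al / q * xpar t z / (t + z)\<bar> * f (xpar t z)"
      unfolding eq[OF z] using al_bounds q_pos by simp
  qed
  moreover have "integral {-1<..<1} (\<lambda>z. \<bar>al / q * xpar t z / (t + z)\<bar> * f (xpar t z)) = al / q * I"
    unfolding I_def integral_mult_right[symmetric] by (rule integral_cong) (use eq in force)
  ultimately have "integral (xpar t ` {-1<..<1}) f = al / q * I"
    using has_absolute_integral_change_of_variables_1'[of "{-1<..<1}" "xpar t"
        "\<lambda>z. al / q * xpar t z / (t + z)" f "al / q * I"]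
      xpar_deriv[OF t] xpar_image(2)[OF r]
    by (auto simp: t_def[symmetric] intro: has_field_derivative_at_within)
  then show ?thesis
    unfolding Theta_base using xpar_image(1)[OF r]
    by (simp add: f_def I_def t_def integral_open_interval_real)
qed

section \<open>The derivative of the period in \<open>r\<close>\<close>

lemma tpar_deriv:
  assumes "r > 1"
  obtains D where "(tpar has_real_derivative D) (at r)" "D < 0"
proof -
  define e where "e = q / al"
  have e: "e > 0" using q_pos al_bounds by (simp add: e_def)
  have y: "r powr e > 1" using assms e by simp
  have "(tpar has_real_derivative - 2 * (e * r powr (e - 1)) / (r powr e - 1)\<^sup>2) (at r)"
    unfolding tpar_def[abs_def] e_def[symmetric] using assms y
    by (auto intro!: derivative_eq_intros simp: power2_eq_square field_simps)
  moreover have "- 2 * (e * r powr (e - 1)) / (r powr e - 1)\<^sup>2 < 0"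
    using e y assms by (intro divide_neg_pos) auto
  ultimately show ?thesis using that by blast
qed

text \<open>Two sign reversals cancel: the integral of \<open>J powr (-1/2)\<close> moves against
  \<open>J\<close>, and \<open>tpar\<close> decreases in \<open>r\<close>. The derivative thus has
  the sign of \<open>dJ\<close>.\<close>

lemma Theta_deriv:
  assumes r: "r > 1"
  obtains D where "((\<lambda>s. Theta p q s) has_real_derivative D) (at r)"
    "g < 1 \<Longrightarrow> q \<le> 2 \<Longrightarrow> D < 0" "g > 1 \<Longrightarrow> q \<ge> 2 \<Longrightarrow> D > 0"
proof -
  define m where "m = 2 / q"
  have m: "m > 0" using q_pos by (simp add: m_def)
  define t where "t = tpar r"
  have t: "t > 1" using r tpar_gt_1 by (simp add: t_def)
  obtain t0 t1 c C where *: "t0 < t" "t < t1" "c > 0" "C > 0"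
    "\<And>s z. s \<in> {t0..t1} \<Longrightarrow> - 1 < z \<Longrightarrow> z < 1 \<Longrightarrow> c * (1 - z\<^sup>2) \<le> J m s z"
    "\<And>s z. s \<in> {t0..t1} \<Longrightarrow> - 1 < z \<Longrightarrow> z < 1 \<Longrightarrow> \<bar>dJ m s z\<bar> \<le> C * (1 - z\<^sup>2)"
    "\<And>s z. s \<in> {t0..t1} \<Longrightarrow> - 1 < z \<Longrightarrow> z < 1 \<Longrightarrow> ((\<lambda>s. J m s z) has_real_derivative dJ m s z) (at s)"
    "\<And>s. s \<in> {t0..t1} \<Longrightarrow> continuous_on {-1<..<1} (J m s)"
    using J_local_bounds[OF t m] by blast
  obtain E where E: "((\<lambda>s. integral {-1<..<1} (\<lambda>z. 1 / sqrt (J m s z))) has_real_derivative E) (at t)"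
    "(\<And>z. - 1 < z \<Longrightarrow> z < 1 \<Longrightarrow> dJ m t z < 0) \<Longrightarrow> E > 0"
    "(\<And>z. - 1 < z \<Longrightarrow> z < 1 \<Longrightarrow> dJ m t z > 0) \<Longrightarrow> E < 0"
    using rsqrt_integral_deriv_sign[of t0 t t1 c C "J m" "dJ m", OF *] by blast
  obtain T' where T': "(tpar has_real_derivative T') (at r)" "T' < 0"
    using tpar_deriv[OF r] by blast
  have "((\<lambda>s. al / q * integral {-1<..<1} (\<lambda>z. 1 / sqrt (J m (tpar s) z))) has_real_derivative
      al / q * (E * T')) (at r)"
    using DERIV_cmult[OF DERIV_chain2[OF E(1)[unfolded t_def] T'(1)], of "al / q"] .
  then have D: "((\<lambda>s. Theta p q s) has_real_derivative al / q * (E * T')) (at r)"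
    by (rule has_field_derivative_transform_within_open[of _ _ _ "{1<..}"])
       (use r Theta_eq in \<open>auto simp: m_def\<close>)
  have k: "al / q > 0" using al_bounds q_pos by simp
  show ?thesis
  proof (rule that[OF D])
    assume "g < 1" "q \<le> 2"
    then have "E > 0"
      using dJ_sign(1)[OF t _ _ m] q_pos by (intro E(2)) (auto simp: m_def field_simps)
    then show "al / q * (E * T') < 0" using k T'(2) by (intro mult_pos_neg) auto
  next
    assume "g > 1" "q \<ge> 2"
    then have "E < 0"
      using dJ_sign(2)[OF t _ _ m] q_pos by (intro E(3)) (auto simp: m_def field_simps)
    then show "al / q * (E * T') > 0" using k T'(2) by (intro mult_pos_pos mult_neg_neg) auto
  qed
qed

lemma Jt_deriv:
  assumes "t > 1" "- 1 < z" "z < 1"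
  shows "((\<lambda>s. Jt p q s z) has_real_derivative dJ (2 / q) t z) (at t)"
  by (rule has_field_derivative_transform_within_open[OF J_deriv[OF assms], of "{1<..}"])
     (use assms Jt_eq in auto)

end

theorem theorem6p3:
  fixes p q :: real
  assumes "p < q" and "q > 0"
  shows "(\<forall>t z. t > 1 \<longrightarrow> -1 < z \<longrightarrow> z < 1 \<longrightarrow>
            ((0 \<le> -p \<and> -p < q \<and> q \<le> 2) \<longrightarrow>
               (\<exists>D. ((\<lambda>s. Jt p q s z) has_real_derivative D) (at t) \<and> D < 0)) \<and>
            ((-p > q \<and> q \<ge> 2) \<longrightarrow>
               (\<exists>D. ((\<lambda>s. Jt p q s z) has_real_derivative D) (at t) \<and> D > 0)))
       \<and> (\<forall>r. r > 1 \<longrightarrow>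
            ((0 \<le> -p \<and> -p < q \<and> q \<le> 2) \<longrightarrow>
               (\<exists>D. ((\<lambda>s. Theta p q s) has_real_derivative D) (at r) \<and> D < 0)) \<and>
            ((-p > q \<and> q \<ge> 2) \<longrightarrow>
               (\<exists>D. ((\<lambda>s. Theta p q s) has_real_derivative D) (at r) \<and> D > 0)))"
proof (cases "p \<le> 0")
  case False
  \<comment> \<open>For \<open>p > 0\<close> the claims are vacuous, since each premise forces
    \<open>p <= 0\<close>.\<close>
  then show ?thesis using assms by auto
next
  case True
  \<comment> \<open>The solution of \<open>al * p = - g * q\<close> and
    \<open>al = (3 - g) / 2\<close>.\<close>
  define g al where "g = - 3 * p / (2 * q - p)" and "al = 3 * q / (2 * q - p)"
  have d: "2 * q - p > 0" using assms True by simp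
  interpret period_function g al p q
  proof
    show "0 \<le> g" "g < 3" "al = (3 - g) / 2" "q > 0" "al * p = - g * q"
      using d assms True by (auto simp: g_def al_def field_simps)
  qed
  have g: "g < 1 \<longleftrightarrow> - p < q" "g > 1 \<longleftrightarrow> - p > q"
    using d by (auto simp: g_def field_simps)
  have "\<exists>D. ((\<lambda>s. Jt p q s z) has_real_derivative D) (at t) \<and> (- p < q \<and> q \<le> 2 \<longrightarrow> D < 0) \<and> (- p > q \<and> q \<ge> 2 \<longrightarrow> D > 0)"
    if tz: "t > 1" "- 1 < z" "z < 1" for t z
    using Jt_deriv[OF tz] dJ_sign[OF tz, of "2 / q"] g assms(2) by (intro exI[of _ "dJ (2 / q) t z"]) auto
  moreover have "\<exists>D. ((\<lambda>s. Theta p q s) has_real_derivative D) (at r) \<and> (- p < q \<and> q \<le> 2 \<longrightarrow> D < 0) \<and> (- p > q \<and> q \<ge> 2 \<longrightarrow> D > 0)"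
    if r: "r > 1" for r
    using Theta_deriv[OF r] g by metis
  ultimately show ?thesis by meson
qed

end
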